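(* Let $T=\{0,\dots,N\}$ and $\mathbb{F}$ a field. Let $C_\bullet$ and $C'_\bullet$ be filtrations (indexed by $T$) of finite-dimensional chain complexes $C=C_N$ and $C'=C'_N$ over $\mathbb{F}$, with filtration compatible ordered bases $\mathfrak{C}=(c_1,\dots,c_n)$ and $\mathfrak{C}'=(c'_1,\dots,c'_n)$ and corresponding filtration boundary matrices $D$ and $D'$. Let $\varphi_\bullet\colon C_\bullet\to C'_\bullet$ be an injective morphism of filtrations of chain complexes such that $\varphi=\varphi_N\colon C\to C'$ is an isomorphism, let $F$ be the matrix of $\varphi$ with respect to $\mathfrak{C}$ and $\mathfrak{C}'$, and set $D^{\varphi}=DF^{-1}=F^{-1}D'$. Suppose $V$ and $V^{\varphi}$ are invertible upper-triangular $n\times n$ matrices such that $R=DV$ and $R^{\varphi}=D^{\varphi}V^{\varphi}$ are reduced. Interpret the columns of $R$, $D$, $V$, $R^\varphi$, $D^\varphi$ as coordinate vectors (hence elements of $C$) with respect to $\mathfrak{C}$, and the columns of $V^{\varphi}$ as coordinate vectors (elements of $C'$) with respect to $\mathfrak{C}'$. Then the persistence module $\operatorname{im}H_*(\varphi_\bullet)$, $t\mapsto\operatorname{im}\big(H_*(\varphi_t)\colon H_*(C_t)\to H_*(C'_t)\big)$, has a barcode given by the multiset union \[ \left\{\operatorname{supp}_{C_\bullet}(r^{\varphi}_j)\setminus\operatorname{supp}_{C'_\bullet}(v^{\varphi}_j)\;\middle|\; r^{\varphi}_j\neq 0,\ \operatorname{supp}_{C_\bullet}(r^{\varphi}_j)\setminus\operatorname{supp}_{C'_\bullet}(v^{\varphi}_j)\neq\emptyset\right\}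 \cup \left\{\operatorname{supp}_{C_\bullet}(v_i)\;\middle|\; r_i=0 \text{ and } i\notin\operatorname{pivs}R^{\varphi}\right\}. \]
   Context: A chain complex here is a finite-dimensional graded $\mathbb{F}$-vector space with a differential $\partial$ of degree $-1$ with $\partial^2=0$. A filtration of a vector space $M$ indexed by $T$ is a chain of subspaces $M_0\subseteq\dots\subseteq M_N=M$; a filtration of chain complexes is such a chain of subcomplexes. The support of $m\in M$ is $\operatorname{supp}_{M_\bullet}(m)=\{t\in T\mid m\in M_t\}$. A basis $\mathfrak{M}$ of $M$ is filtration compatible if $\mathfrak{M}\cap M_t$ is a basis of $M_t$ for all $t$; an ordered basis is a filtration compatible ordered basis if it is filtration compatible and $m\le m'$ implies $\operatorname{supp}(m')\subseteq\operatorname{supp}(m)$. The filtration boundary matrix is the matrix of $\partial$ on $C$ in the given filtration compatible ordered basis. For a matrix $X$, $x_j$ denotes its $j$-th column; for a nonzero column $x_j$, $\operatorname{piv}x_j$ is the largest row index of a nonzero entry; $\operatorname{pivs}X$ is the set of pivots of nonzero columns of $X$; $X$ is reduced if no two nonzero columns have the same pivot. A persistence module indexed by $T$ (a functor from the poset $T$ to $\mathbb{F}$-vector spaces) has barcode $(I_\alpha)$ (a multiset of intervals of $T$) if it is isomorphic to $\bigoplus_\alpha C(I_\alpha)$, where the interval module $C(I)$ is $\mathbb{F}$ at $t\in I$, $0$ otherwise, with identity structure maps within $I$ and zero otherwise. *)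

theory Defs
  imports "Jordan_Normal_Form.VS_Connect"
begin

text \<open>Conventions.  Throughout, the index set is T = {0..N}.  A chain complex C with a
  chosen ordered basis c_1..c_n is represented in coordinates w.r.t. that basis:
  C is the space of vectors of dimension n over the field 'a (elements are coordinate
  vectors), the i-th basis vector c_(i+1) is unit_vec n i (indices are 0-based), and the
  differential is multiplication with the filtration boundary matrix D.
  A filtration is a function Cf :: nat => 'a vec set, Cf t being the subspace C_t.\<close>

abbreviation Vn :: "'a::field itself \<Rightarrow> nat \<Rightarrow> ('a, 'a vec) module" where
  "Vn ty n \<equiv> module_vec ty n"

text \<open>Support of an element m w.r.t. a filtration indexed by {0..N}.\<close>
definition supp :: "nat \<Rightarrow> (nat \<Rightarrow> 'a vec set) \<Rightarrow> 'a vec \<Rightarrow> nat set" where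
  "supp N Cf m = {t. t \<le> N \<and> m \<in> Cf t}"

text \<open>Cf is a filtration of the vector space F^n indexed by {0..N}.\<close>
definition is_filtration :: "nat \<Rightarrow> nat \<Rightarrow> (nat \<Rightarrow> 'a::field vec set) \<Rightarrow> bool" where
  "is_filtration n N Cf \<longleftrightarrow>
     (\<forall>t\<le>N. subspace (class_ring :: 'a ring) (Cf t) (module_vec TYPE('a) n)) \<and>
     (\<forall>s t. s \<le> t \<and> t \<le> N \<longrightarrow> Cf s \<subseteq> Cf t) \<and>
     Cf N = carrier_vec n"

text \<open>The standard (coordinate) basis, i.e. the chosen basis c_1,...,c_n, is a filtration
  compatible ordered basis of the filtration Cf.\<close>
definition compatible_ordered_basis :: "nat \<Rightarrow> nat \<Rightarrow> (nat \<Rightarrow> 'a::field vec set) \<Rightarrow> bool" where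
  "compatible_ordered_basis n N Cf \<longleftrightarrow>
     (\<forall>t\<le>N. vectorspace.basis (class_ring :: 'a ring)
                ((module_vec TYPE('a) n)\<lparr>carrier := Cf t\<rparr>)
                ({unit_vec n i | i. i < n} \<inter> Cf t)) \<and>
     (\<forall>i j. i \<le> j \<and> j < n \<longrightarrow>
        supp N Cf (unit_vec n j) \<subseteq> supp N Cf (unit_vec n i))"

text \<open>D is the matrix (w.r.t. the chosen basis) of a differential of degree -1 on a graded
  space whose i-th basis vector is homogeneous of degree deg i, squaring to zero, and every
  C_t is a subcomplex.\<close>
definition filtered_chain_complex ::
  "nat \<Rightarrow> nat \<Rightarrow> (nat \<Rightarrow> int) \<Rightarrow> (nat \<Rightarrow> 'a::field vec set) \<Rightarrow> 'a mat \<Rightarrow> bool" where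
  "filtered_chain_complex n N deg Cf D \<longleftrightarrow>
     D \<in> carrier_mat n n \<and> D * D = 0\<^sub>m n n \<and>
     (\<forall>i j. i < n \<and> j < n \<and> D $$ (i, j) \<noteq> 0 \<longrightarrow> deg i = deg j - 1) \<and>
     is_filtration n N Cf \<and>
     (\<forall>t\<le>N. \<forall>v\<in>Cf t. D *\<^sub>v v \<in> Cf t)"

text \<open>Pivots and reduced matrices.\<close>
definition piv :: "'a::zero mat \<Rightarrow> nat \<Rightarrow> nat" where
  "piv X j = Max {i. i < dim_row X \<and> X $$ (i, j) \<noteq> 0}"

definition pivs :: "'a::zero mat \<Rightarrow> nat set" where
  "pivs X = {piv X j | j. j < dim_col X \<and> col X j \<noteq> 0\<^sub>v (dim_row X)}"

definition reduced :: "'a::zero mat \<Rightarrow> bool" where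
  "reduced X \<longleftrightarrow> (\<forall>j1 j2. j1 < dim_col X \<and> j2 < dim_col X \<and> j1 \<noteq> j2 \<and>
      col X j1 \<noteq> 0\<^sub>v (dim_row X) \<and> col X j2 \<noteq> 0\<^sub>v (dim_row X) \<longrightarrow> piv X j1 \<noteq> piv X j2)"

subsection \<open>Persistence modules\<close>

text \<open>A persistence module indexed by {0..N}: vector spaces M t (t \<le> N) and linear
  structure maps f s t : M s -> M t (s \<le> t) forming a functor.\<close>
definition pers_mod :: "nat \<Rightarrow> (nat \<Rightarrow> ('a::field, 'b) module) \<Rightarrow> (nat \<Rightarrow> nat \<Rightarrow> 'b \<Rightarrow> 'b) \<Rightarrow> bool" where
  "pers_mod N M f \<longleftrightarrow>
     (\<forall>t\<le>N. vectorspace (class_ring :: 'a ring) (M t)) \<and>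
     (\<forall>s t. s \<le> t \<and> t \<le> N \<longrightarrow> f s t \<in> LinearCombinations.module_hom (class_ring :: 'a ring) (M s) (M t)) \<and>
     (\<forall>t\<le>N. \<forall>x\<in>carrier (M t). f t t x = x) \<and>
     (\<forall>r s t. r \<le> s \<and> s \<le> t \<and> t \<le> N \<longrightarrow> (\<forall>x\<in>carrier (M r). f s t (f r s x) = f r t x))"

text \<open>Isomorphism of persistence modules: a natural family of linear bijections.\<close>
definition pers_iso ::
  "nat \<Rightarrow> (nat \<Rightarrow> ('a::field, 'b) module) \<Rightarrow> (nat \<Rightarrow> nat \<Rightarrow> 'b \<Rightarrow> 'b)
       \<Rightarrow> (nat \<Rightarrow> ('a, 'c) module) \<Rightarrow> (nat \<Rightarrow> nat \<Rightarrow> 'c \<Rightarrow> 'c) \<Rightarrow> bool" where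
  "pers_iso N M f M' f' \<longleftrightarrow>
     (\<exists>\<eta>. (\<forall>t\<le>N. \<eta> t \<in> LinearCombinations.module_hom (class_ring :: 'a ring) (M t) (M' t) \<and>
                  bij_betw (\<eta> t) (carrier (M t)) (carrier (M' t))) \<and>
          (\<forall>s t. s \<le> t \<and> t \<le> N \<longrightarrow> (\<forall>x\<in>carrier (M s). \<eta> t (f s t x) = f' s t (\<eta> s x))))"

text \<open>Intervals of T = {0..N}.\<close>
definition is_interval :: "nat \<Rightarrow> nat set \<Rightarrow> bool" where
  "is_interval N I \<longleftrightarrow> I \<noteq> {} \<and> I \<subseteq> {0..N} \<and>
     (\<forall>a\<in>I. \<forall>b\<in>I. \<forall>c. a \<le> c \<and> c \<le> b \<longrightarrow> c \<in> I)"

text \<open>The direct sum of the interval modules C(L!0), ..., C(L!(k-1)), k = length L: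
  at t it consists of the k-tuples whose alpha-th entry vanishes unless t \<in> L!alpha;
  the structure map from s to t is the identity on the alpha-th summand if s,t \<in> L!alpha
  and zero otherwise.\<close>
definition int_sum_mod :: "'a::field itself \<Rightarrow> nat set list \<Rightarrow> nat \<Rightarrow> ('a, 'a vec) module" where
  "int_sum_mod ty L t = (module_vec ty (length L))\<lparr>carrier :=
      {v \<in> carrier_vec (length L). \<forall>j < length L. t \<notin> L ! j \<longrightarrow> v $ j = 0}\<rparr>"

definition int_sum_map :: "nat set list \<Rightarrow> nat \<Rightarrow> nat \<Rightarrow> 'a::field vec \<Rightarrow> 'a vec" where
  "int_sum_map L s t v = vec (length L) (\<lambda>j. if s \<in> L ! j \<and> t \<in> L ! j then v $ j else 0)"

text \<open>A persistence module has barcode B (a multiset of intervals) iff it is isomorphic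
  to the direct sum of the interval modules C(I), I \<in># B.\<close>
definition has_barcode ::
  "nat \<Rightarrow> (nat \<Rightarrow> ('a::field, 'b) module) \<Rightarrow> (nat \<Rightarrow> nat \<Rightarrow> 'b \<Rightarrow> 'b) \<Rightarrow> nat set multiset \<Rightarrow> bool" where
  "has_barcode N M f B \<longleftrightarrow> pers_mod N M f \<and> (\<forall>I\<in>#B. is_interval N I) \<and>
     (\<exists>L. mset L = B \<and> pers_iso N M f (int_sum_mod TYPE('a) L) (int_sum_map L))"

subsection \<open>Homology and the image persistence module\<close>

definition cycles :: "'a::field mat \<Rightarrow> 'a vec set \<Rightarrow> 'a vec set" where
  "cycles D W = {v \<in> W. D *\<^sub>v v = 0\<^sub>v (dim_row D)}"

definition boundaries :: "'a::field mat \<Rightarrow> 'a vec set \<Rightarrow> 'a vec set" where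
  "boundaries D W = {D *\<^sub>v v | v. v \<in> W}"

text \<open>Homology class x + B of a cycle x modulo the boundaries B.\<close>
definition hclass :: "'a vec set \<Rightarrow> 'a::field vec \<Rightarrow> 'a vec set" where
  "hclass B x = (\<lambda>b. x + b) ` B"

text \<open>The vector space of classes x + B (x ranging over S), with the quotient operations.\<close>
definition quot_mod :: "nat \<Rightarrow> 'a::field vec set \<Rightarrow> 'a vec set \<Rightarrow> ('a, 'a vec set) module" where
  "quot_mod n B S = \<lparr> carrier = hclass B ` S, mult = undefined, one = undefined,
     zero = B,
     add = (\<lambda>X Y. {x + y | x y. x \<in> X \<and> y \<in> Y}),
     smult = (\<lambda>c X. {c \<cdot>\<^sub>v x + b | x b. x \<in> X \<and> b \<in> B}) \<rparr>"

text \<open>im H_*(phi_t) = { [F z] : z a cycle of C_t } \<subseteq> H_*(C'_t) = Z(C'_t)/B(C'_t),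
  where F is the matrix of phi and D, D' the boundary matrices.\<close>
definition imH_mod :: "nat \<Rightarrow> (nat \<Rightarrow> 'a::field vec set) \<Rightarrow> 'a mat
      \<Rightarrow> (nat \<Rightarrow> 'a vec set) \<Rightarrow> 'a mat \<Rightarrow> 'a mat \<Rightarrow> nat \<Rightarrow> ('a, 'a vec set) module" where
  "imH_mod n Cf D C'f D' F t =
     quot_mod n (boundaries D' (C'f t)) ((\<lambda>z. F *\<^sub>v z) ` cycles D (Cf t))"

text \<open>Structure maps of im H_*(phi_.), induced by the inclusions C'_s \<subseteq> C'_t.\<close>
definition imH_map :: "(nat \<Rightarrow> 'a::field vec set) \<Rightarrow> 'a mat \<Rightarrow> nat \<Rightarrow> nat \<Rightarrow> 'a vec set \<Rightarrow> 'a vec set" where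
  "imH_map C'f D' s t X = {x + b | x b. x \<in> X \<and> b \<in> boundaries D' (C'f t)}"

end

theory Submission
  imports Defs
begin

text \<open>Everything is done in the coordinates of the given bases; write r_j, v_j, r'_j, v'_j
  for the columns of R, V, Rphi, Vphi. The generators of the image module are the nonzero r'_j,
  alive on supp r'_j - supp v'_j, and the v_i with r_i = 0 and i \<notin> pivs Rphi, alive on
  supp v_i. They are cycles, and since Rphi is reduced their pivots are pairwise distinct.

  Every cycle z of C_t is a combination of generators alive at t plus an element of
  Dphi(C'_t): its pivot b is eliminated by r'_j if b is the pivot of r'_j (then either
  v'_j \<in> C'_t and r'_j = Dphi v'_j, or t lies in the bar of r'_j), and by v_b otherwise,
  because r_b = 0 when b is the pivot of a cycle and R is reduced. As F Dphi = D', the classes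
  of the images of the generators alive at t span the image at t. They are independent: if
  F (\<Sum> c_g g) = D' w, then \<Sum> c_g g = Dphi w = Rphi u with u supported on the j with
  v'_j \<in> C'_t, while the pivot of the left side is the pivot of an alive generator, which
  differs from the pivots of all these r'_j. Finally F r'_j = D' v'_j becomes a boundary
  exactly when v'_j enters C', so the structure maps are those of the interval modules.\<close>

section \<open>Pivots\<close>

definition vec_piv :: "'a::zero vec \<Rightarrow> nat" where
  "vec_piv v = Max {i. i < dim_vec v \<and> v $ i \<noteq> 0}"

lemma
  assumes "v \<noteq> 0\<^sub>v (dim_vec v)"
  shows vec_piv_less: "vec_piv v < dim_vec v"
    and vec_piv_nonzero: "v $ vec_piv v \<noteq> 0"
proof -
  have "{i. i < dim_vec v \<and> v $ i \<noteq> 0} \<noteq> {}"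
    using assms by (auto intro: eq_vecI)
  then have "vec_piv v \<in> {i. i < dim_vec v \<and> v $ i \<noteq> 0}"
    unfolding vec_piv_def by (intro Max_in) auto
  then show "vec_piv v < dim_vec v" "v $ vec_piv v \<noteq> 0" by auto
qed

lemma vec_piv_above_zero:
  assumes "vec_piv v < i" "i < dim_vec v"
  shows "v $ i = 0"
proof (rule ccontr)
  assume "v $ i \<noteq> 0"
  then have "i \<le> vec_piv v"
    unfolding vec_piv_def using assms(2) by (intro Max_ge) auto
  then show False using assms(1) by simp
qed

lemma vec_piv_eqI:
  assumes "i < dim_vec v" "v $ i \<noteq> 0" "\<And>j. i < j \<Longrightarrow> j < dim_vec v \<Longrightarrow> v $ j = 0"
  shows "vec_piv v = i"
  unfolding vec_piv_def using assms by (intro Max_eqI) (auto intro: leI)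

lemma vec_piv_ge_nonzero:
  assumes "j < dim_vec v" "v $ j \<noteq> 0"
  shows "j \<le> vec_piv v"
  using vec_piv_above_zero[of v j] assms by (meson not_le)

lemma piv_eq_vec_piv: "piv X j = vec_piv (col X j)"
  unfolding piv_def vec_piv_def col_def by (intro arg_cong[where f = Max]) auto

lemma pivs_iff: "b \<in> pivs X \<longleftrightarrow> (\<exists>j<dim_col X. col X j \<noteq> 0\<^sub>v (dim_row X) \<and> vec_piv (col X j) = b)"
  unfolding pivs_def piv_eq_vec_piv by auto

lemma reduced_inj_on_vec_piv:
  assumes "reduced X"
  shows "inj_on (\<lambda>j. vec_piv (col X j)) {j. j < dim_col X \<and> col X j \<noteq> 0\<^sub>v (dim_row X)}"
  using assms unfolding reduced_def piv_eq_vec_piv by (auto intro: inj_onI)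

lemma index_mult_mat_vec_sum:
  "A \<in> carrier_mat m n \<Longrightarrow> u \<in> carrier_vec n \<Longrightarrow> i < m \<Longrightarrow>
    (A *\<^sub>v u) $ i = (\<Sum>j\<in>{0..<n}. A $$ (i, j) * u $ j)"
  by (simp add: scalar_prod_def)

lemma index_mult_mat_vec_support:
  fixes A :: "'a::comm_semiring_0 mat"
  assumes A: "A \<in> carrier_mat m n" and u: "u \<in> carrier_vec n" and i: "i < m"
  shows "(A *\<^sub>v u) $ i = (\<Sum>j\<in>{j. j < n \<and> col A j \<noteq> 0\<^sub>v m \<and> u $ j \<noteq> 0}. u $ j * col A j $ i)"
proof -
  have "A $$ (i, j) = 0" if "j < n" "col A j = 0\<^sub>v m" for j
    using that i A by (metis carrier_matD index_col index_zero_vec(1))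
  then have "(\<Sum>j\<in>{0..<n}. A $$ (i, j) * u $ j) =
      (\<Sum>j\<in>{j. j < n \<and> col A j \<noteq> 0\<^sub>v m \<and> u $ j \<noteq> 0}. u $ j * col A j $ i)"
    using i A by (intro sum.mono_neutral_cong_right) (auto simp: mult.commute)
  then show ?thesis using index_mult_mat_vec_sum[OF A u i] by simp
qed

lemma mult_mat_vec_distinct_col_pivs:
  fixes A :: "'a::field mat" and u :: "'a vec" and m n :: nat
  defines "S \<equiv> {j. j < n \<and> col A j \<noteq> 0\<^sub>v m \<and> u $ j \<noteq> 0}"
  assumes A: "A \<in> carrier_mat m n" and u: "u \<in> carrier_vec n" and ne: "S \<noteq> {}"
    and inj: "inj_on (\<lambda>j. vec_piv (col A j)) S"
  obtains j where "j \<in> S" "A *\<^sub>v u \<noteq> 0\<^sub>v m" "vec_piv (A *\<^sub>v u) = vec_piv (col A j)"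
proof -
  let ?p = "Max ((\<lambda>j. vec_piv (col A j)) ` S)"
  have fin: "finite S" unfolding S_def by simp
  have "?p \<in> (\<lambda>j. vec_piv (col A j)) ` S" using fin ne by (intro Max_in) auto
  then obtain j0 where j0: "j0 \<in> S" and p: "?p = vec_piv (col A j0)" by auto
  have le_p: "vec_piv (col A j) \<le> ?p" if "j \<in> S" for j using fin that by (intro Max_ge) auto
  have col0: "dim_vec (col A j0) = m" "col A j0 \<noteq> 0\<^sub>v (dim_vec (col A j0))"
    using j0 A unfolding S_def by auto
  have pm: "?p < m" using p vec_piv_less[OF col0(2)] col0(1) by simp
  have above: "col A j $ i = 0" if "j \<in> S" "?p < i" "i < m" for j i
    using vec_piv_above_zero[of "col A j" i] le_p[OF that(1)] A that(2,3) by simp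
  have at_p: "col A j $ ?p = 0" if "j \<in> S" "j \<noteq> j0" for j
  proof -
    have "vec_piv (col A j) \<noteq> ?p" using inj that j0 p unfolding inj_on_def by auto
    then show ?thesis using vec_piv_above_zero[of "col A j" ?p] le_p[OF that(1)] A pm by simp
  qed
  note entry = index_mult_mat_vec_support[OF A u, folded S_def]
  have "(A *\<^sub>v u) $ ?p = u $ j0 * col A j0 $ ?p"
    using entry[OF pm] at_p fin j0 by (simp add: sum.remove[of _ j0])
  then have up: "(A *\<^sub>v u) $ ?p \<noteq> 0"
    using j0 vec_piv_nonzero[OF col0(2)] p unfolding S_def by simp
  have "vec_piv (A *\<^sub>v u) = ?p"
  proof (rule vec_piv_eqI)
    show "?p < dim_vec (A *\<^sub>v u)" using pm A by simp
    show "(A *\<^sub>v u) $ i = 0" if "?p < i" "i < dim_vec (A *\<^sub>v u)" for i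
      using entry[of i] above[of _ i] that A by simp
  qed (rule up)
  moreover have "A *\<^sub>v u \<noteq> 0\<^sub>v m" using up pm by auto
  ultimately show thesis using that j0 p by simp
qed

lemma reduced_mult_vec_piv:
  fixes X :: "'a::field mat"
  assumes X: "X \<in> carrier_mat m n" "reduced X" and u: "u \<in> carrier_vec n" and Xu: "X *\<^sub>v u \<noteq> 0\<^sub>v m"
  obtains j where "j < n" "col X j \<noteq> 0\<^sub>v m" "u $ j \<noteq> 0" "vec_piv (X *\<^sub>v u) = vec_piv (col X j)"
proof -
  let ?S = "{j. j < n \<and> col X j \<noteq> 0\<^sub>v m \<and> u $ j \<noteq> 0}"
  have "?S \<noteq> {}"
  proof
    assume "?S = {}"
    then have "X *\<^sub>v u = 0\<^sub>v m"
      using index_mult_mat_vec_support[OF X(1) u, unfolded \<open>?S = {}\<close>] X(1) by (intro eq_vecI) auto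
    then show False using Xu by simp
  qed
  moreover have "inj_on (\<lambda>j. vec_piv (col X j)) ?S"
    using reduced_inj_on_vec_piv[OF X(2)] X(1) by (auto intro: inj_on_subset)
  ultimately show thesis using mult_mat_vec_distinct_col_pivs[OF X(1) u] that by blast
qed

lemma reduced_mult_vec_nonzero:
  fixes X :: "'a::field mat"
  assumes X: "X \<in> carrier_mat m n" "reduced X" and u: "u \<in> carrier_vec n"
    and j: "j < n" "col X j \<noteq> 0\<^sub>v m" "u $ j \<noteq> 0"
  shows "X *\<^sub>v u \<noteq> 0\<^sub>v m"
proof -
  let ?S = "{j. j < n \<and> col X j \<noteq> 0\<^sub>v m \<and> u $ j \<noteq> 0}"
  have "?S \<noteq> {}" using j by auto
  moreover have "inj_on (\<lambda>j. vec_piv (col X j)) ?S"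
    using reduced_inj_on_vec_piv[OF X(2)] X(1) by (auto intro: inj_on_subset)
  ultimately show ?thesis using mult_mat_vec_distinct_col_pivs[OF X(1) u] by blast
qed

section \<open>Subspaces of coordinate space and their quotients\<close>

definition vec_subspace :: "nat \<Rightarrow> 'a::field vec set \<Rightarrow> bool" where
  "vec_subspace n W \<longleftrightarrow> W \<subseteq> carrier_vec n \<and> 0\<^sub>v n \<in> W \<and>
     (\<forall>x\<in>W. \<forall>y\<in>W. x + y \<in> W) \<and> (\<forall>c. \<forall>x\<in>W. c \<cdot>\<^sub>v x \<in> W)"

lemma mult_mat_vec_unit_vec:
  fixes A :: "'a::semiring_1 mat"
  shows "A \<in> carrier_mat m n \<Longrightarrow> j < n \<Longrightarrow> A *\<^sub>v unit_vec n j = col A j"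
  by (intro eq_vecI) auto

context
  fixes n :: nat and W :: "'a::field vec set"
  assumes W: "vec_subspace n W"
begin

lemma vec_subspace_carrier: "x \<in> W \<Longrightarrow> x \<in> carrier_vec n"
  using W unfolding vec_subspace_def by auto

lemma vec_subspace_zero: "0\<^sub>v n \<in> W"
  using W unfolding vec_subspace_def by auto

lemma vec_subspace_add: "x \<in> W \<Longrightarrow> y \<in> W \<Longrightarrow> x + y \<in> W"
  using W unfolding vec_subspace_def by auto

lemma vec_subspace_smult: "x \<in> W \<Longrightarrow> c \<cdot>\<^sub>v x \<in> W"
  using W unfolding vec_subspace_def by auto

lemma vec_subspace_diff:
  assumes "x \<in> W" "y \<in> W"
  shows "x - y \<in> W"
proof -
  have "x - y = x + (-1) \<cdot>\<^sub>v y"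
    using assms vec_subspace_carrier by (intro eq_vecI) auto
  then show ?thesis using assms vec_subspace_add vec_subspace_smult by simp
qed

lemma mult_mat_vec_in_vec_subspace:
  assumes X: "X \<in> carrier_mat n m" and c: "c \<in> carrier_vec m"
    and cols: "\<And>j. j < m \<Longrightarrow> c $ j \<noteq> 0 \<Longrightarrow> col X j \<in> W"
  shows "X *\<^sub>v c \<in> W"
proof -
  define c_upto where "c_upto k = vec m (\<lambda>j. if j < k then c $ j else 0)" for k
  have "X *\<^sub>v c_upto k \<in> W" if "k \<le> m" for k
    using that
  proof (induction k)
    case 0
    have "c_upto 0 = 0\<^sub>v m" unfolding c_upto_def by auto
    then have "X *\<^sub>v c_upto 0 = 0\<^sub>v n" using X by (intro eq_vecI) auto
    then show ?case using vec_subspace_zero by simp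
  next
    case (Suc k)
    have "c_upto (Suc k) = c_upto k + c $ k \<cdot>\<^sub>v unit_vec m k"
      unfolding c_upto_def using Suc.prems by (intro eq_vecI) (auto simp: less_Suc_eq)
    moreover have "X *\<^sub>v unit_vec m k = col X k"
      using X Suc.prems by (simp add: mult_mat_vec_unit_vec)
    ultimately have "X *\<^sub>v c_upto (Suc k) = X *\<^sub>v c_upto k + c $ k \<cdot>\<^sub>v col X k"
      using X Suc.prems by (simp add: c_upto_def mult_add_distrib_mat_vec mult_mat_vec)
    moreover have "c $ k \<cdot>\<^sub>v col X k \<in> W"
    proof (cases "c $ k = 0")
      case True
      then have "c $ k \<cdot>\<^sub>v col X k = 0\<^sub>v n" using X by (intro eq_vecI) auto
      then show ?thesis using vec_subspace_zero by simp
    qed (use cols Suc.prems vec_subspace_smult in auto)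
    ultimately show ?case using Suc vec_subspace_add by simp
  qed
  moreover have "c_upto m = c" unfolding c_upto_def using c by (intro eq_vecI) auto
  ultimately show ?thesis by (metis order_refl)
qed

end

lemma subspace_imp_vec_subspace:
  assumes "subspace (class_ring :: 'a::field ring) W (module_vec TYPE('a) n)"
  shows "vec_subspace n W"
proof -
  from assms have sub: "submodule (class_ring :: 'a ring) W (module_vec TYPE('a) n)"
    unfolding subspace_def by auto
  show ?thesis unfolding vec_subspace_def
    using submodule.subset[OF sub] submodule.zero_closed[OF sub] submodule.m_closed[OF sub]
      submodule.smult_closed[OF sub]
    by (auto simp: module_vec_simps class_ring_simps)
qed

lemma vec_subspace_cycles:
  assumes D: "D \<in> carrier_mat m n" and W: "vec_subspace n W"
  shows "vec_subspace n (cycles D W)"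
  unfolding vec_subspace_def cycles_def
proof (intro conjI ballI allI)
  show "{v \<in> W. D *\<^sub>v v = 0\<^sub>v (dim_row D)} \<subseteq> carrier_vec n"
    using vec_subspace_carrier[OF W] by auto
  have "D *\<^sub>v 0\<^sub>v n = 0\<^sub>v (dim_row D)" using D by (intro eq_vecI) auto
  then show "0\<^sub>v n \<in> {v \<in> W. D *\<^sub>v v = 0\<^sub>v (dim_row D)}" using vec_subspace_zero[OF W] by simp
next
  fix x y assume x: "x \<in> {v \<in> W. D *\<^sub>v v = 0\<^sub>v (dim_row D)}"
    and y: "y \<in> {v \<in> W. D *\<^sub>v v = 0\<^sub>v (dim_row D)}"
  then have "D *\<^sub>v (x + y) = 0\<^sub>v (dim_row D)"
    using D vec_subspace_carrier[OF W] by (simp add: mult_add_distrib_mat_vec)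
  then show "x + y \<in> {v \<in> W. D *\<^sub>v v = 0\<^sub>v (dim_row D)}"
    using x y vec_subspace_add[OF W] by simp
next
  fix c x assume x: "x \<in> {v \<in> W. D *\<^sub>v v = 0\<^sub>v (dim_row D)}"
  then have "D *\<^sub>v (c \<cdot>\<^sub>v x) = c \<cdot>\<^sub>v 0\<^sub>v (dim_row D)"
    using D vec_subspace_carrier[OF W] by (simp add: mult_mat_vec)
  also have "\<dots> = 0\<^sub>v (dim_row D)" by (intro eq_vecI) auto
  finally have "D *\<^sub>v (c \<cdot>\<^sub>v x) = 0\<^sub>v (dim_row D)" .
  then show "c \<cdot>\<^sub>v x \<in> {v \<in> W. D *\<^sub>v v = 0\<^sub>v (dim_row D)}"
    using x vec_subspace_smult[OF W] by simp
qed

lemma vec_subspace_image: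
  assumes A: "A \<in> carrier_mat m n" and W: "vec_subspace n W"
  shows "vec_subspace m ((*\<^sub>v) A ` W)"
  unfolding vec_subspace_def
proof (intro conjI ballI allI)
  show "(*\<^sub>v) A ` W \<subseteq> carrier_vec m" using A vec_subspace_carrier[OF W] by auto
  have "A *\<^sub>v 0\<^sub>v n = 0\<^sub>v m" using A by (intro eq_vecI) auto
  then show "0\<^sub>v m \<in> (*\<^sub>v) A ` W"
    using vec_subspace_zero[OF W] by (auto intro!: image_eqI[where x = "0\<^sub>v n"])
next
  fix x y assume "x \<in> (*\<^sub>v) A ` W" "y \<in> (*\<^sub>v) A ` W"
  then obtain v w where vw: "v \<in> W" "w \<in> W" "x = A *\<^sub>v v" "y = A *\<^sub>v w" by auto
  then have "x + y = A *\<^sub>v (v + w)"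
    using A vec_subspace_carrier[OF W] by (simp add: mult_add_distrib_mat_vec)
  then show "x + y \<in> (*\<^sub>v) A ` W" using vw vec_subspace_add[OF W] by simp
next
  fix c x assume "x \<in> (*\<^sub>v) A ` W"
  then obtain v where v: "v \<in> W" "x = A *\<^sub>v v" by auto
  then have "c \<cdot>\<^sub>v x = A *\<^sub>v (c \<cdot>\<^sub>v v)"
    using A vec_subspace_carrier[OF W] by (simp add: mult_mat_vec)
  then show "c \<cdot>\<^sub>v x \<in> (*\<^sub>v) A ` W" using v vec_subspace_smult[OF W] by simp
qed

lemma vec_subspace_set_plus:
  assumes A: "vec_subspace n A" and B: "vec_subspace n B"
  shows "vec_subspace n {a + b | a b. a \<in> A \<and> b \<in> B}" (is "vec_subspace n ?P")
  unfolding vec_subspace_def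
proof (intro conjI ballI allI)
  note car = vec_subspace_carrier[OF A] vec_subspace_carrier[OF B]
  show "?P \<subseteq> carrier_vec n" using car by auto
  show "0\<^sub>v n \<in> ?P"
    using vec_subspace_zero[OF A] vec_subspace_zero[OF B]
    by (intro CollectI exI[of _ "0\<^sub>v n"] conjI) auto
next
  fix x y assume "x \<in> ?P" "y \<in> ?P"
  then obtain a b a' b' where ab: "a \<in> A" "b \<in> B" "a' \<in> A" "b' \<in> B" "x = a + b" "y = a' + b'"
    by blast
  show "x + y \<in> ?P"
  proof (intro CollectI exI conjI)
    show "x + y = (a + a') + (b + b')"
      using ab(5,6) vec_subspace_carrier[OF A ab(1)] vec_subspace_carrier[OF A ab(3)]
        vec_subspace_carrier[OF B ab(2)] vec_subspace_carrier[OF B ab(4)]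
      by (intro eq_vecI) auto
  qed (use ab vec_subspace_add[OF A] vec_subspace_add[OF B] in auto)
next
  fix c x assume "x \<in> ?P"
  then obtain a b where ab: "a \<in> A" "b \<in> B" "x = a + b" by blast
  show "c \<cdot>\<^sub>v x \<in> ?P"
  proof (intro CollectI exI conjI)
    show "c \<cdot>\<^sub>v x = c \<cdot>\<^sub>v a + c \<cdot>\<^sub>v b"
      using ab vec_subspace_carrier[OF A, of a] vec_subspace_carrier[OF B, of b]
      by (simp add: smult_add_distrib_vec)
  qed (use ab vec_subspace_smult[OF A] vec_subspace_smult[OF B] in auto)
qed

lemma hclass_add:
  assumes B: "vec_subspace n B" and x: "x \<in> carrier_vec n" and y: "y \<in> carrier_vec n"
  shows "{a + b | a b. a \<in> hclass B x \<and> b \<in> hclass B y} = hclass B (x + y)"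
proof (rule equalityI; rule subsetI)
  fix z assume "z \<in> {a + b | a b. a \<in> hclass B x \<and> b \<in> hclass B y}"
  then obtain b1 b2 where b: "b1 \<in> B" "b2 \<in> B" and z: "z = (x + b1) + (y + b2)"
    unfolding hclass_def by blast
  have "z = (x + y) + (b1 + b2)"
    unfolding z using x y vec_subspace_carrier[OF B b(1)] vec_subspace_carrier[OF B b(2)]
    by (intro eq_vecI) auto
  then show "z \<in> hclass B (x + y)" unfolding hclass_def using vec_subspace_add[OF B b] by auto
next
  fix z assume "z \<in> hclass B (x + y)"
  then obtain b where b: "b \<in> B" and z: "z = (x + y) + b" unfolding hclass_def by auto
  have "z = (x + b) + (y + 0\<^sub>v n)"
    unfolding z using x y vec_subspace_carrier[OF B b] by (intro eq_vecI) auto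
  then show "z \<in> {a + b | a b. a \<in> hclass B x \<and> b \<in> hclass B y}"
    unfolding hclass_def using b vec_subspace_zero[OF B] by blast
qed

lemma hclass_smult:
  assumes B: "vec_subspace n B" and x: "x \<in> carrier_vec n"
  shows "{c \<cdot>\<^sub>v a + b | a b. a \<in> hclass B x \<and> b \<in> B} = hclass B (c \<cdot>\<^sub>v x)"
proof (rule equalityI; rule subsetI)
  fix z assume "z \<in> {c \<cdot>\<^sub>v a + b | a b. a \<in> hclass B x \<and> b \<in> B}"
  then obtain b1 b2 where b: "b1 \<in> B" "b2 \<in> B" and z: "z = c \<cdot>\<^sub>v (x + b1) + b2"
    unfolding hclass_def by blast
  have "z = c \<cdot>\<^sub>v x + (c \<cdot>\<^sub>v b1 + b2)"
    unfolding z using x vec_subspace_carrier[OF B b(1)] vec_subspace_carrier[OF B b(2)]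
    by (intro eq_vecI) (auto simp: algebra_simps)
  then show "z \<in> hclass B (c \<cdot>\<^sub>v x)"
    unfolding hclass_def using vec_subspace_add[OF B vec_subspace_smult[OF B b(1)] b(2)] by auto
next
  fix z assume "z \<in> hclass B (c \<cdot>\<^sub>v x)"
  then obtain b where b: "b \<in> B" and z: "z = c \<cdot>\<^sub>v x + b" unfolding hclass_def by auto
  have "z = c \<cdot>\<^sub>v (x + 0\<^sub>v n) + b"
    unfolding z using x vec_subspace_carrier[OF B b] by (intro eq_vecI) auto
  then show "z \<in> {c \<cdot>\<^sub>v a + b | a b. a \<in> hclass B x \<and> b \<in> B}"
    unfolding hclass_def using b vec_subspace_zero[OF B] by blast
qed

lemma hclass_subset_if_diff:
  assumes B: "vec_subspace n B" and x: "x \<in> carrier_vec n" and y: "y \<in> carrier_vec n"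
    and xy: "x - y \<in> B"
  shows "hclass B x \<subseteq> hclass B y"
proof
  fix z assume "z \<in> hclass B x"
  then obtain b where b: "b \<in> B" and z: "z = x + b" unfolding hclass_def by auto
  have "z = y + ((x - y) + b)"
    unfolding z using x y vec_subspace_carrier[OF B b] by (intro eq_vecI) auto
  then show "z \<in> hclass B y" unfolding hclass_def using vec_subspace_add[OF B xy b] by auto
qed

lemma hclass_eq_iff:
  assumes B: "vec_subspace n B" and x: "x \<in> carrier_vec n" and y: "y \<in> carrier_vec n"
  shows "hclass B x = hclass B y \<longleftrightarrow> x - y \<in> B"
proof
  assume eq: "hclass B x = hclass B y"
  have "x + 0\<^sub>v n \<in> hclass B x" unfolding hclass_def using vec_subspace_zero[OF B] by blast
  then obtain b where b: "b \<in> B" and "x = y + b" using x eq unfolding hclass_def by auto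
  then have "x - y = b" using y vec_subspace_carrier[OF B b] by (intro eq_vecI) auto
  then show "x - y \<in> B" using b by simp
next
  assume xy: "x - y \<in> B"
  have "y - x = (-1) \<cdot>\<^sub>v (x - y)" using x y by (intro eq_vecI) auto
  then have "y - x \<in> B" using vec_subspace_smult[OF B xy] by simp
  then show "hclass B x = hclass B y"
    using hclass_subset_if_diff[OF B x y xy] hclass_subset_if_diff[OF B y x] by blast
qed

lemma hclass_zero: "vec_subspace n B \<Longrightarrow> hclass B (0\<^sub>v n) = B"
  unfolding hclass_def by (auto simp: image_iff vec_subspace_carrier)

definition quot_map :: "'a::plus vec set \<Rightarrow> 'a vec set \<Rightarrow> 'a vec set" where
  "quot_map B X = {x + b | x b. x \<in> X \<and> b \<in> B}"

lemma quot_map_hclass: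
  assumes B: "vec_subspace n B" and B': "B' \<subseteq> B" "0\<^sub>v n \<in> B'" and x: "x \<in> carrier_vec n"
  shows "quot_map B (hclass B' x) = hclass B x"
proof (rule equalityI; rule subsetI)
  fix z assume "z \<in> quot_map B (hclass B' x)"
  then obtain b1 b2 where b: "b1 \<in> B" "b2 \<in> B" and z: "z = (x + b1) + b2"
    unfolding quot_map_def hclass_def using B' by blast
  have "z = x + (b1 + b2)"
    unfolding z using x vec_subspace_carrier[OF B b(1)] vec_subspace_carrier[OF B b(2)]
    by (intro eq_vecI) auto
  then show "z \<in> hclass B x" unfolding hclass_def using vec_subspace_add[OF B b] by auto
next
  fix z assume "z \<in> hclass B x"
  then obtain b where b: "b \<in> B" and z: "z = x + b" unfolding hclass_def by auto
  have "z = (x + 0\<^sub>v n) + b" unfolding z using x vec_subspace_carrier[OF B b] by (intro eq_vecI) auto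
  then show "z \<in> quot_map B (hclass B' x)"
    unfolding quot_map_def hclass_def using b B'(2) by blast
qed

lemma imH_map_eq_quot_map: "imH_map C'f D' s t = quot_map (boundaries D' (C'f t))"
  unfolding imH_map_def quot_map_def by (rule ext) simp

lemma carrier_quot_mod: "carrier (quot_mod n B S) = hclass B ` S"
  unfolding quot_mod_def by simp

lemma zero_quot_mod: "vec_subspace n B \<Longrightarrow> \<zero>\<^bsub>quot_mod n B S\<^esub> = hclass B (0\<^sub>v n)"
  unfolding quot_mod_def by (simp add: hclass_zero)

lemma add_quot_mod_hclass:
  "vec_subspace n B \<Longrightarrow> x \<in> carrier_vec n \<Longrightarrow> y \<in> carrier_vec n \<Longrightarrow>
    hclass B x \<oplus>\<^bsub>quot_mod n B S\<^esub> hclass B y = hclass B (x + y)"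
  unfolding quot_mod_def by (simp add: hclass_add)

lemma smult_quot_mod_hclass:
  "vec_subspace n B \<Longrightarrow> x \<in> carrier_vec n \<Longrightarrow>
    c \<odot>\<^bsub>quot_mod n B S\<^esub> hclass B x = hclass B (c \<cdot>\<^sub>v x)"
  unfolding quot_mod_def by (simp add: hclass_smult)

lemma vectorspace_quot_mod:
  assumes B: "vec_subspace n B" and S: "vec_subspace n S"
  shows "vectorspace class_ring (quot_mod n B S)"
proof -
  let ?Q = "quot_mod n B S"
  note car = vec_subspace_carrier[OF S]
  have add: "hclass B x \<oplus>\<^bsub>?Q\<^esub> hclass B y = hclass B (x + y)" if "x \<in> S" "y \<in> S" for x y
    using add_quot_mod_hclass[OF B car car] that .
  have smult: "c \<odot>\<^bsub>?Q\<^esub> hclass B x = hclass B (c \<cdot>\<^sub>v x)" if "x \<in> S" for c x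
    using smult_quot_mod_hclass[OF B car] that .
  note closed = vec_subspace_add[OF S] vec_subspace_smult[OF S]
  have "module class_ring ?Q"
  proof (rule module_criteria, unfold carrier_quot_mod zero_quot_mod[OF B])
    show "cring (class_ring :: 'a ring)" by (rule class_cring.cring_axioms)
    show "hclass B (0\<^sub>v n) \<in> hclass B ` S" using vec_subspace_zero[OF S] by simp
    show "\<forall>v\<in>hclass B ` S. \<exists>w\<in>hclass B ` S. v \<oplus>\<^bsub>?Q\<^esub> w = hclass B (0\<^sub>v n)"
    proof
      fix v assume "v \<in> hclass B ` S"
      then obtain x where x: "x \<in> S" "v = hclass B x" by auto
      have "x + (-1) \<cdot>\<^sub>v x = 0\<^sub>v n" using car[OF x(1)] by (intro eq_vecI) auto
      then show "\<exists>w\<in>hclass B ` S. v \<oplus>\<^bsub>?Q\<^esub> w = hclass B (0\<^sub>v n)"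
        using x add closed by (intro bexI[of _ "hclass B ((-1) \<cdot>\<^sub>v x)"]) auto
    qed
    show "\<forall>v w. v \<in> hclass B ` S \<and> w \<in> hclass B ` S \<longrightarrow> v \<oplus>\<^bsub>?Q\<^esub> w = w \<oplus>\<^bsub>?Q\<^esub> v"
      by (auto simp: add comm_add_vec[OF car car])
  qed (auto simp: add smult closed car vec_subspace_zero[OF S] assoc_add_vec[of _ n] smult_add_distrib_vec[of _ n] add_smult_distrib_vec
      smult_smult_assoc class_ring_simps)
  then show ?thesis
    unfolding vectorspace_def using class_field by (auto simp: class_field_def)
qed

lemma pivot_elimination:
  fixes z r :: "'a::field vec"
  assumes zr: "z \<in> carrier_vec n" "r \<in> carrier_vec n" "r $ b \<noteq> 0"
    and above: "\<And>i. b < i \<Longrightarrow> i < n \<Longrightarrow> z $ i = 0" "\<And>i. b < i \<Longrightarrow> i < n \<Longrightarrow> r $ i = 0"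
    and i: "b \<le> i" "i < n"
  shows "(z - (z $ b / r $ b) \<cdot>\<^sub>v r) $ i = 0"
  using zr above[of i] i by (cases "i = b") auto

lemma vec_subspace_subset_if_pivots:
  fixes W Q :: "'a::field vec set"
  assumes W: "vec_subspace n W" and Q: "vec_subspace n Q"
    and reducer: "\<And>z. z \<in> W \<Longrightarrow> z \<noteq> 0\<^sub>v n \<Longrightarrow> \<exists>r\<in>W \<inter> Q. r \<noteq> 0\<^sub>v n \<and> vec_piv r = vec_piv z"
  shows "W \<subseteq> Q"
proof -
  have vanish: "z \<in> Q" if "z \<in> W" "\<And>i. b \<le> i \<Longrightarrow> i < n \<Longrightarrow> z $ i = 0" for b z
    using that
  proof (induction b arbitrary: z)
    case 0
    then have "z = 0\<^sub>v n" using vec_subspace_carrier[OF W] by (intro eq_vecI) auto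
    then show ?case using vec_subspace_zero[OF Q] by simp
  next
    case (Suc b)
    have zc: "z \<in> carrier_vec n" using vec_subspace_carrier[OF W Suc.prems(1)] .
    show ?case
    proof (cases "b < n \<and> z $ b \<noteq> 0")
      case False
      then have "z $ i = 0" if "b \<le> i" "i < n" for i
        using that Suc.prems(2)[of i] by (cases "i = b") auto
      then show ?thesis using Suc.IH[OF Suc.prems(1)] by blast
    next
      case True
      then have "z \<noteq> 0\<^sub>v n" by auto
      have "vec_piv z = b" using True zc Suc.prems(2) by (intro vec_piv_eqI) auto
      then obtain r where r: "r \<in> W" "r \<in> Q" "r \<noteq> 0\<^sub>v n" "vec_piv r = b"
        using reducer[OF Suc.prems(1) \<open>z \<noteq> 0\<^sub>v n\<close>] by auto
      have rc: "r \<in> carrier_vec n" using vec_subspace_carrier[OF W r(1)] .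
      have rb: "r $ b \<noteq> 0" using vec_piv_nonzero[of r] r(3,4) rc by auto
      define c where "c = z $ b / r $ b"
      have "z - c \<cdot>\<^sub>v r \<in> W"
        using vec_subspace_diff[OF W Suc.prems(1) vec_subspace_smult[OF W r(1)]] .
      moreover have "(z - c \<cdot>\<^sub>v r) $ i = 0" if "b \<le> i" "i < n" for i
        unfolding c_def using pivot_elimination[OF zc rc rb _ _ that] Suc.prems(2)
          vec_piv_above_zero[of r] r(4) rc by simp
      ultimately have "z - c \<cdot>\<^sub>v r \<in> Q" using Suc.IH by blast
      then have "(z - c \<cdot>\<^sub>v r) + c \<cdot>\<^sub>v r \<in> Q"
        using vec_subspace_add[OF Q _ vec_subspace_smult[OF Q r(2)]] by blast
      moreover have "(z - c \<cdot>\<^sub>v r) + c \<cdot>\<^sub>v r = z" using zc rc by (intro eq_vecI) auto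
      ultimately show ?thesis by simp
    qed
  qed
  show ?thesis using vanish[of _ n] by auto
qed

section \<open>Upper triangular matrices\<close>

lemma invertible_mat_inverse:
  assumes "invertible_mat A" "A \<in> carrier_mat n n"
  obtains B where "B \<in> carrier_mat n n" "A * B = 1\<^sub>m n" "B * A = 1\<^sub>m n"
proof -
  from assms obtain B where AB: "A * B = 1\<^sub>m n" and BA: "B * A = 1\<^sub>m (dim_row B)"
    unfolding invertible_mat_def inverts_mat_def by auto
  have "dim_col B = n" using arg_cong[OF AB, of dim_col] by simp
  moreover have "dim_row B = n" using arg_cong[OF BA, of dim_col] assms(2) by simp
  ultimately show thesis using that AB BA by auto
qed

lemma invertible_mat_solve:
  assumes "invertible_mat A" "A \<in> carrier_mat n n" "w \<in> carrier_vec n"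
  obtains u where "u \<in> carrier_vec n" "A *\<^sub>v u = w"
proof -
  obtain B where B: "B \<in> carrier_mat n n" "A * B = 1\<^sub>m n"
    using invertible_mat_inverse[OF assms(1,2)] by blast
  have "A *\<^sub>v (B *\<^sub>v w) = w"
    using assms(2,3) B by (simp flip: assoc_mult_mat_vec)
  then show thesis using that[of "B *\<^sub>v w"] B(1) assms(3) by simp
qed

lemma upper_triangular_diag_nonzero:
  fixes V :: "'a::field mat"
  assumes V: "V \<in> carrier_mat n n" "upper_triangular V" "invertible_mat V" and i: "i < n"
  shows "V $$ (i, i) \<noteq> 0"
proof -
  obtain W where W: "W \<in> carrier_mat n n" "V * W = 1\<^sub>m n"
    using invertible_mat_inverse[OF V(3,1)] by blast
  have "det V * det W = 1" using det_mult[OF V(1) W(1)] W(2) by simp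
  then have "0 \<notin> set (diag_mat V)"
    using upper_triangular_imp_det_eq_0_iff[OF V(1,2)] by auto
  then show ?thesis using i V(1) by (auto simp: diag_mat_def)
qed

lemma upper_triangular_mult_vec_index:
  assumes V: "V \<in> carrier_mat n n" "upper_triangular V" and u: "u \<in> carrier_vec n"
    and p: "\<And>j. p < j \<Longrightarrow> j < n \<Longrightarrow> u $ j = 0" and i: "p \<le> i" "i < n"
  shows "(V *\<^sub>v u) $ i = (if i = p then V $$ (p, p) * u $ p else 0)"
proof -
  have summand: "V $$ (i, j) * u $ j = (if j = i \<and> i = p then V $$ (p, p) * u $ p else 0)"
    if "j < n" for j
  proof (cases j i rule: linorder_cases)
    case less
    then show ?thesis using upper_triangularD[OF V(2) less] V(1) i by simp
  next
    case greater
    then show ?thesis using p[of j] i that by simp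
  next
    case equal
    then show ?thesis using p[of j] i that by auto
  qed
  have "(V *\<^sub>v u) $ i = (\<Sum>j\<in>{0..<n}. V $$ (i, j) * u $ j)"
    using index_mult_mat_vec_sum[OF V(1) u i(2)] .
  also have "\<dots> = (\<Sum>j\<in>{0..<n}. if j = i \<and> i = p then V $$ (p, p) * u $ p else 0)"
    using summand by (intro sum.cong) auto
  also have "\<dots> = (if i = p then V $$ (p, p) * u $ p else 0)"
    using i by simp
  finally show ?thesis .
qed

lemma
  fixes V :: "'a::field mat"
  assumes V: "V \<in> carrier_mat n n" "upper_triangular V" and diag: "\<And>i. i < n \<Longrightarrow> V $$ (i, i) \<noteq> 0"
    and u: "u \<in> carrier_vec n" "u \<noteq> 0\<^sub>v n"
  shows upper_triangular_mult_vec_nonzero: "V *\<^sub>v u \<noteq> 0\<^sub>v n"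
    and vec_piv_upper_triangular_mult: "vec_piv (V *\<^sub>v u) = vec_piv u"
proof -
  let ?p = "vec_piv u"
  have p: "?p < n" "u $ ?p \<noteq> 0" using vec_piv_less[of u] vec_piv_nonzero[of u] u by auto
  have above: "\<And>j. ?p < j \<Longrightarrow> j < n \<Longrightarrow> u $ j = 0" using vec_piv_above_zero[of u] u(1) by auto
  note entry = upper_triangular_mult_vec_index[OF V u(1), of ?p, OF above]
  have piv_entry: "(V *\<^sub>v u) $ ?p \<noteq> 0" using entry[of ?p] p diag[OF p(1)] by simp
  then show "V *\<^sub>v u \<noteq> 0\<^sub>v n" using p(1) by auto
  show "vec_piv (V *\<^sub>v u) = ?p"
  proof (rule vec_piv_eqI)
    show "?p < dim_vec (V *\<^sub>v u)" using p V(1) by simp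
    show "(V *\<^sub>v u) $ j = 0" if "?p < j" "j < dim_vec (V *\<^sub>v u)" for j
      using entry[of j] that V(1) by simp
  qed (rule piv_entry)
qed

lemma upper_triangular_col:
  fixes V :: "'a::field mat"
  assumes V: "V \<in> carrier_mat n n" "upper_triangular V" "invertible_mat V" and j: "j < n"
  shows "col V j \<noteq> 0\<^sub>v n" "vec_piv (col V j) = j"
proof -
  have "col V j $ j \<noteq> 0" using upper_triangular_diag_nonzero[OF V j] V(1) j by simp
  then show "col V j \<noteq> 0\<^sub>v n" using j by auto
  show "vec_piv (col V j) = j"
    using upper_triangular_diag_nonzero[OF V j] upper_triangularD[OF V(2)] V(1) j
    by (intro vec_piv_eqI) auto
qed

lemma reduced_col_zero_at_cycle_piv:
  fixes D V R :: "'a::field mat"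
  assumes D: "D \<in> carrier_mat n n"
    and V: "V \<in> carrier_mat n n" "upper_triangular V" "invertible_mat V"
    and R: "R = D * V" "reduced R"
    and z: "z \<in> carrier_vec n" "z \<noteq> 0\<^sub>v n" "D *\<^sub>v z = 0\<^sub>v n"
  shows "col R (vec_piv z) = 0\<^sub>v n"
proof -
  obtain u where u: "u \<in> carrier_vec n" "V *\<^sub>v u = z"
    using invertible_mat_solve[OF V(3,1) z(1)] by blast
  have "u \<noteq> 0\<^sub>v n" using u z(2) V(1) by auto
  then have piv: "vec_piv u = vec_piv z"
    using vec_piv_upper_triangular_mult[OF V(1,2) upper_triangular_diag_nonzero[OF V] u(1)] u(2)
    by simp
  have ub: "u $ vec_piv z \<noteq> 0" "vec_piv z < n"
    using vec_piv_nonzero[of u] vec_piv_less[of u] \<open>u \<noteq> 0\<^sub>v n\<close> u(1) piv by auto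
  have Rc: "R \<in> carrier_mat n n" using R(1) D V(1) by simp
  have Ru: "R *\<^sub>v u = 0\<^sub>v n" using R(1) D V(1) u z(3) by simp
  show ?thesis
    using reduced_mult_vec_nonzero[OF Rc R(2) u(1) ub(2) _ ub(1)] Ru by auto
qed

section \<open>Filtrations with compatible bases\<close>

lemma is_filtration_vec_subspace: "is_filtration n N Cf \<Longrightarrow> t \<le> N \<Longrightarrow> vec_subspace n (Cf t)"
  unfolding is_filtration_def by (auto intro: subspace_imp_vec_subspace)

lemma is_filtration_mono: "is_filtration n N Cf \<Longrightarrow> s \<le> t \<Longrightarrow> t \<le> N \<Longrightarrow> Cf s \<subseteq> Cf t"
  unfolding is_filtration_def by simp

lemma supp_up_closed:
  "is_filtration n N Cf \<Longrightarrow> s \<in> supp N Cf v \<Longrightarrow> s \<le> t \<Longrightarrow> t \<le> N \<Longrightarrow> t \<in> supp N Cf v"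
  using is_filtration_mono[of n N Cf s t] unfolding supp_def by auto

lemma is_interval_supp:
  assumes "is_filtration n N Cf" "v \<in> carrier_vec n"
  shows "is_interval N (supp N Cf v)"
proof -
  have "N \<in> supp N Cf v" using assms unfolding supp_def is_filtration_def by simp
  then show ?thesis
    unfolding is_interval_def using supp_up_closed[OF assms(1)] by (auto simp: supp_def)
qed

lemma is_interval_supp_diff:
  assumes "is_filtration n N Cf" "is_filtration m N C'f"
    and "supp N Cf v - supp N C'f w \<noteq> {}"
  shows "is_interval N (supp N Cf v - supp N C'f w)"
  unfolding is_interval_def
proof (intro conjI ballI allI impI)
  fix a b c assume a: "a \<in> supp N Cf v - supp N C'f w" and b: "b \<in> supp N Cf v - supp N C'f w"
    and c: "a \<le> c \<and> c \<le> b"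
  have "b \<le> N" using b by (simp add: supp_def)
  then show "c \<in> supp N Cf v - supp N C'f w"
    using a b c supp_up_closed[OF assms(1), of a v c] supp_up_closed[OF assms(2), of c w b] by auto
qed (use assms(3) in \<open>auto simp: supp_def\<close>)

context
  fixes n N :: nat and Cf :: "nat \<Rightarrow> 'a::field vec set" and t :: nat
  assumes filt: "is_filtration n N Cf" and basis: "compatible_ordered_basis n N Cf" and t: "t \<le> N"
begin

lemma compatible_basis_unit_vec_mem:
  assumes v: "v \<in> Cf t" and i: "i < n" "v $ i \<noteq> 0"
  shows "unit_vec n i \<in> Cf t"
proof (rule ccontr)
  assume not_mem: "unit_vec n i \<notin> Cf t"
  let ?U = "{unit_vec n j | j. j < n} \<inter> Cf t"
  let ?M = "module_vec TYPE('a) n"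
  let ?W = "{w \<in> carrier_vec n. w $ i = 0}"
  have sub: "subspace class_ring (Cf t) ?M" using filt t unfolding is_filtration_def by simp
  then have sm: "submodule class_ring (Cf t) ?M" unfolding subspace_def by auto
  have "vectorspace.basis class_ring (?M\<lparr>carrier := Cf t\<rparr>) ?U"
    using basis t unfolding compatible_ordered_basis_def by simp
  then have "LinearCombinations.module.span class_ring (?M\<lparr>carrier := Cf t\<rparr>) ?U = Cf t"
    using vectorspace.basis_def[OF vectorspace.subspace_is_vs[OF vec_vs sub]] by auto
  also have "LinearCombinations.module.span class_ring (?M\<lparr>carrier := Cf t\<rparr>) ?U =
      LinearCombinations.module.span class_ring ?M ?U"
    by (rule module.span_li_not_depend(1)[OF vec_module _ sm]) auto
  finally have span: "LinearCombinations.module.span class_ring ?M ?U = Cf t" .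
  have "submodule class_ring ?W ?M"
    unfolding submodule_def using vec_module i by (auto simp: module_vec_simps class_ring_simps)
  moreover have "?U \<subseteq> ?W"
  proof
    fix x assume "x \<in> ?U"
    then obtain j where j: "j < n" "x = unit_vec n j" "x \<in> Cf t" by auto
    then show "x \<in> ?W" using not_mem i by (cases "j = i") auto
  qed
  ultimately have "LinearCombinations.module.span class_ring ?M ?U \<subseteq> ?W"
    by (intro module.span_is_subset[OF vec_module])
  then show False using span v i by auto
qed

lemma compatible_basis_unit_vec_le:
  assumes "unit_vec n j \<in> Cf t" "i \<le> j" "j < n"
  shows "unit_vec n i \<in> Cf t"
proof -
  have "supp N Cf (unit_vec n j) \<subseteq> supp N Cf (unit_vec n i)"
    using basis assms(2,3) unfolding compatible_ordered_basis_def by simp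
  then show ?thesis using assms(1) t unfolding supp_def by auto
qed

lemma compatible_basis_mem_if_vanishes_above:
  assumes x: "x \<in> Cf t" "p < n" "x $ p \<noteq> 0"
    and v: "v \<in> carrier_vec n" "\<And>i. p < i \<Longrightarrow> i < n \<Longrightarrow> v $ i = 0"
  shows "v \<in> Cf t"
proof -
  have "1\<^sub>m n *\<^sub>v v \<in> Cf t"
  proof (rule mult_mat_vec_in_vec_subspace[OF is_filtration_vec_subspace[OF filt t] _ v(1)])
    fix i assume "i < n" "v $ i \<noteq> 0"
    then have "i \<le> p" using v(2) by (meson not_le)
    then show "col (1\<^sub>m n) i \<in> Cf t"
      using compatible_basis_unit_vec_le[OF compatible_basis_unit_vec_mem[OF x] _ x(2)] \<open>i < n\<close>
      by simp
  qed simp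
  then show ?thesis using v(1) by simp
qed

lemma upper_triangular_solve_in_filtration:
  assumes V: "V \<in> carrier_mat n n" "upper_triangular V" "invertible_mat V" and w: "w \<in> Cf t"
  obtains u where "u \<in> carrier_vec n" "V *\<^sub>v u = w" "\<And>j. j < n \<Longrightarrow> u $ j \<noteq> 0 \<Longrightarrow> col V j \<in> Cf t"
proof -
  have wc: "w \<in> carrier_vec n" using vec_subspace_carrier[OF is_filtration_vec_subspace[OF filt t] w] .
  obtain u where u: "u \<in> carrier_vec n" "V *\<^sub>v u = w" using invertible_mat_solve[OF V(3,1) wc] .
  have "col V j \<in> Cf t" if j: "j < n" "u $ j \<noteq> 0" for j
  proof -
    have "u \<noteq> 0\<^sub>v n" using j by auto
    then have piv: "vec_piv w = vec_piv u" "w \<noteq> 0\<^sub>v n"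
      using vec_piv_upper_triangular_mult[OF V(1,2) upper_triangular_diag_nonzero[OF V] u(1)]
        upper_triangular_mult_vec_nonzero[OF V(1,2) upper_triangular_diag_nonzero[OF V] u(1)] u(2)
      by auto
    have "j \<le> vec_piv w" using vec_piv_ge_nonzero[of j u] j u(1) piv(1) by simp
    then show ?thesis
      using vec_piv_less[of w] vec_piv_nonzero[of w] piv(2) wc upper_triangularD[OF V(2)] V(1) j(1)
      by (intro compatible_basis_mem_if_vanishes_above[OF w]) auto
  qed
  then show thesis using that u by blast
qed

end

section \<open>Persistence modules of quotients\<close>

lemma quot_map_module_hom:
  assumes B: "vec_subspace n B" and B': "vec_subspace n B'"
    and S: "vec_subspace n S" and sub: "B \<subseteq> B'" "S \<subseteq> S'"
  shows "quot_map B' \<in> LinearCombinations.module_hom class_ring (quot_mod n B S) (quot_mod n B' S')"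
proof -
  note car = vec_subspace_carrier[OF S]
  have shift: "quot_map B' (hclass B x) = hclass B' x" if "x \<in> S" for x
    using quot_map_hclass[OF B' sub(1) vec_subspace_zero[OF B] car[OF that]] .
  show ?thesis
    unfolding LinearCombinations.module_hom_def carrier_quot_mod
  proof (intro CollectI conjI allI impI)
    show "quot_map B' \<in> hclass B ` S \<rightarrow> hclass B' ` S'" using shift sub(2) by auto
  next
    fix X Y assume "X \<in> hclass B ` S \<and> Y \<in> hclass B ` S"
    then obtain x y where xy: "x \<in> S" "y \<in> S" "X = hclass B x" "Y = hclass B y" by auto
    then show "quot_map B' (X \<oplus>\<^bsub>quot_mod n B S\<^esub> Y) =
        quot_map B' X \<oplus>\<^bsub>quot_mod n B' S'\<^esub> quot_map B' Y"
      using shift vec_subspace_add[OF S] car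
      by (simp add: add_quot_mod_hclass[OF B] add_quot_mod_hclass[OF B'])
  next
    fix c :: 'a and X assume "c \<in> carrier class_ring \<and> X \<in> hclass B ` S"
    then obtain x where x: "x \<in> S" "X = hclass B x" by auto
    then show "quot_map B' (c \<odot>\<^bsub>quot_mod n B S\<^esub> X) = c \<odot>\<^bsub>quot_mod n B' S'\<^esub> quot_map B' X"
      using shift vec_subspace_smult[OF S] car
      by (simp add: smult_quot_mod_hclass[OF B] smult_quot_mod_hclass[OF B'])
  qed
qed

lemma pers_mod_quot_mod:
  fixes B S :: "nat \<Rightarrow> 'a::field vec set"
  assumes B: "\<And>t. t \<le> N \<Longrightarrow> vec_subspace n (B t)" and S: "\<And>t. t \<le> N \<Longrightarrow> vec_subspace n (S t)"
    and B_mono: "\<And>s t. s \<le> t \<Longrightarrow> t \<le> N \<Longrightarrow> B s \<subseteq> B t"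
    and S_mono: "\<And>s t. s \<le> t \<Longrightarrow> t \<le> N \<Longrightarrow> S s \<subseteq> S t"
  shows "pers_mod N (\<lambda>t. quot_mod n (B t) (S t)) (\<lambda>s t. quot_map (B t))"
  unfolding pers_mod_def
proof (intro conjI allI impI ballI)
  fix t assume "t \<le> N"
  then show "vectorspace class_ring (quot_mod n (B t) (S t))"
    using vectorspace_quot_mod B S by blast
next
  fix s t assume "s \<le> t \<and> t \<le> N"
  then show "quot_map (B t) \<in> LinearCombinations.module_hom class_ring
      (quot_mod n (B s) (S s)) (quot_mod n (B t) (S t))"
    by (intro quot_map_module_hom B S B_mono S_mono) auto
next
  fix t X assume t: "t \<le> N" and "X \<in> carrier (quot_mod n (B t) (S t))"
  then obtain x where "x \<in> S t" "X = hclass (B t) x" by (auto simp: carrier_quot_mod)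
  then show "quot_map (B t) X = X"
    using quot_map_hclass[OF B[OF t] order_refl vec_subspace_zero[OF B[OF t]]]
      vec_subspace_carrier[OF S[OF t]] by simp
next
  fix r s t X assume rst: "r \<le> s \<and> s \<le> t \<and> t \<le> N" and "X \<in> carrier (quot_mod n (B r) (S r))"
  then obtain x where x: "x \<in> S r" "X = hclass (B r) x" by (auto simp: carrier_quot_mod)
  have rN: "r \<le> N" using rst by auto
  have shift: "quot_map (B t') (hclass (B s') x) = hclass (B t') x"
    if "s' \<le> t'" "t' \<le> N" "r \<le> s'" for s' t'
  proof (rule quot_map_hclass)
    show "x \<in> carrier_vec n" using x(1) rN vec_subspace_carrier[OF S] by simp
  qed (use that B B_mono vec_subspace_zero[OF B] in auto)
  show "quot_map (B t) (quot_map (B s) X) = quot_map (B t) X"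
    using shift[of r s] shift[of s t] shift[of r t] rst x(2) by simp
qed

lemma carrier_int_sum_mod:
  "carrier (int_sum_mod TYPE('a::field) L t) =
    {v \<in> carrier_vec (length L). \<forall>j < length L. t \<notin> L ! j \<longrightarrow> v $ j = 0}"
  unfolding int_sum_mod_def by simp

lemma int_sum_mod_ops:
  "add (int_sum_mod TYPE('a::field) L t) = (+)" "smult (int_sum_mod TYPE('a) L t) = (\<cdot>\<^sub>v)"
  unfolding int_sum_mod_def by (simp_all add: module_vec_simps)

lemma vec_subspace_int_sum_mod: "vec_subspace (length L) (carrier (int_sum_mod TYPE('a::field) L t))"
  unfolding carrier_int_sum_mod vec_subspace_def by auto

lemma int_sum_map_carrier:
  "a \<in> carrier (int_sum_mod TYPE('a::field) L s) \<Longrightarrow>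
    int_sum_map L s t a \<in> carrier (int_sum_mod TYPE('a) L t)"
  unfolding carrier_int_sum_mod int_sum_map_def by auto

lemma the_inv_into_hclass_module_hom:
  fixes M :: "'a::field mat" and B :: "'a vec set"
  defines "\<psi> a \<equiv> hclass B (M *\<^sub>v a)"
  assumes B: "vec_subspace n B" and M: "M \<in> carrier_mat n (length L)"
    and bij: "bij_betw \<psi> (carrier (int_sum_mod TYPE('a) L t)) (carrier (quot_mod n B S))"
  shows "the_inv_into (carrier (int_sum_mod TYPE('a) L t)) \<psi>
    \<in> LinearCombinations.module_hom class_ring (quot_mod n B S) (int_sum_mod TYPE('a) L t)"
proof -
  let ?A = "carrier (int_sum_mod TYPE('a) L t)" and ?Q = "quot_mod n B S"
  define \<eta> where "\<eta> = the_inv_into ?A \<psi>"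
  have A_car: "a \<in> ?A \<Longrightarrow> a \<in> carrier_vec (length L)" for a
    by (simp add: carrier_int_sum_mod)
  have \<eta>_\<psi>: "\<eta> (\<psi> a) = a" if "a \<in> ?A" for a
    unfolding \<eta>_def using bij that by (simp add: bij_betw_def the_inv_into_f_f)
  have \<psi>_surj: "\<exists>a\<in>?A. X = \<psi> a" if "X \<in> carrier ?Q" for X
    using bij that unfolding bij_betw_def by auto
  have \<psi>_add: "\<psi> a \<oplus>\<^bsub>?Q\<^esub> \<psi> b = \<psi> (a + b)" if "a \<in> ?A" "b \<in> ?A" for a b
    unfolding \<psi>_def using that M A_car by (simp add: add_quot_mod_hclass[OF B] mult_add_distrib_mat_vec)
  have \<psi>_smult: "c \<odot>\<^bsub>?Q\<^esub> \<psi> a = \<psi> (c \<cdot>\<^sub>v a)" if "a \<in> ?A" for a c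
    unfolding \<psi>_def using that M A_car by (simp add: smult_quot_mod_hclass[OF B] mult_mat_vec)
  show ?thesis
    unfolding \<eta>_def[symmetric] LinearCombinations.module_hom_def
  proof (intro CollectI conjI allI impI)
    show "\<eta> \<in> carrier ?Q \<rightarrow> ?A"
      using bij_betw_the_inv_into[OF bij] unfolding \<eta>_def bij_betw_def by auto
  next
    fix X Y assume "X \<in> carrier ?Q \<and> Y \<in> carrier ?Q"
    then obtain a b where ab: "a \<in> ?A" "b \<in> ?A" "X = \<psi> a" "Y = \<psi> b" using \<psi>_surj by meson
    then show "\<eta> (X \<oplus>\<^bsub>?Q\<^esub> Y) = \<eta> X \<oplus>\<^bsub>int_sum_mod TYPE('a) L t\<^esub> \<eta> Y"
      using \<psi>_add \<eta>_\<psi> vec_subspace_add[OF vec_subspace_int_sum_mod ab(1,2)]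
      by (simp add: int_sum_mod_ops)
  next
    fix c :: 'a and X assume "c \<in> carrier class_ring \<and> X \<in> carrier ?Q"
    then obtain a where a: "a \<in> ?A" "X = \<psi> a" using \<psi>_surj by meson
    then show "\<eta> (c \<odot>\<^bsub>?Q\<^esub> X) = c \<odot>\<^bsub>int_sum_mod TYPE('a) L t\<^esub> \<eta> X"
      using \<psi>_smult \<eta>_\<psi> vec_subspace_smult[OF vec_subspace_int_sum_mod a(1)]
      by (simp add: int_sum_mod_ops)
  qed
qed

lemma pers_iso_int_sum_mod:
  fixes M :: "'a::field mat" and B S :: "nat \<Rightarrow> 'a vec set"
  defines "\<psi> t a \<equiv> hclass (B t) (M *\<^sub>v a)"
  assumes B: "\<And>t. t \<le> N \<Longrightarrow> vec_subspace n (B t)"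
    and B_mono: "\<And>s t. s \<le> t \<Longrightarrow> t \<le> N \<Longrightarrow> B s \<subseteq> B t"
    and M: "M \<in> carrier_mat n (length L)"
    and bij: "\<And>t. t \<le> N \<Longrightarrow>
      bij_betw (\<psi> t) (carrier (int_sum_mod TYPE('a) L t)) (carrier (quot_mod n (B t) (S t)))"
    and natural: "\<And>s t a. s \<le> t \<Longrightarrow> t \<le> N \<Longrightarrow> a \<in> carrier (int_sum_mod TYPE('a) L s) \<Longrightarrow>
      M *\<^sub>v a - M *\<^sub>v int_sum_map L s t a \<in> B t"
  shows "pers_iso N (\<lambda>t. quot_mod n (B t) (S t)) (\<lambda>s t. quot_map (B t))
    (int_sum_mod TYPE('a) L) (int_sum_map L)"
proof -
  let ?A = "\<lambda>t. carrier (int_sum_mod TYPE('a) L t)"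
  define \<eta> where "\<eta> t = the_inv_into (?A t) (\<psi> t)" for t
  have A_car: "a \<in> ?A t \<Longrightarrow> a \<in> carrier_vec (length L)" for a t
    by (simp add: carrier_int_sum_mod)
  have \<eta>_\<psi>: "\<eta> t (\<psi> t a) = a" if "t \<le> N" "a \<in> ?A t" for t a
    unfolding \<eta>_def using bij[OF that(1)] that(2) by (simp add: bij_betw_def the_inv_into_f_f)
  show ?thesis
    unfolding pers_iso_def
  proof (intro exI[of _ \<eta>] conjI allI impI ballI)
    fix t assume t: "t \<le> N"
    show "bij_betw (\<eta> t) (carrier (quot_mod n (B t) (S t))) (?A t)"
      unfolding \<eta>_def by (rule bij_betw_the_inv_into[OF bij[OF t]])
    show "\<eta> t \<in> LinearCombinations.module_hom class_ring (quot_mod n (B t) (S t))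
        (int_sum_mod TYPE('a) L t)"
      unfolding \<eta>_def \<psi>_def using the_inv_into_hclass_module_hom[OF B[OF t] M] bij[OF t]
      unfolding \<psi>_def by blast
  next
    fix s t X assume st: "s \<le> t \<and> t \<le> N" and X: "X \<in> carrier (quot_mod n (B s) (S s))"
    then obtain a where a: "a \<in> ?A s" "X = \<psi> s a"
      using bij[of s] unfolding bij_betw_def by auto
    let ?a' = "int_sum_map L s t a"
    have a': "?a' \<in> ?A t" using int_sum_map_carrier[OF a(1)] .
    have "quot_map (B t) X = hclass (B t) (M *\<^sub>v a)"
      unfolding a(2) \<psi>_def using st B B_mono M A_car[OF a(1)]
      by (intro quot_map_hclass) (auto intro: vec_subspace_zero)
    also have "\<dots> = \<psi> t ?a'"
      unfolding \<psi>_def using st M A_car[OF a(1)] A_car[OF a'] natural[OF _ _ a(1)]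
      by (subst hclass_eq_iff[OF B]) auto
    finally show "\<eta> t (quot_map (B t) X) = int_sum_map L s t (\<eta> s X)"
      using \<eta>_\<psi> a a' st by simp
  qed
qed

section \<open>The image persistence module\<close>

lemma boundaries_eq_image: "boundaries D W = (*\<^sub>v) D ` W"
  unfolding boundaries_def by auto

locale image_barcode =
  fixes n N :: nat
    and Cf C'f :: "nat \<Rightarrow> 'a::field vec set"
    and D D' F G Dphi V Vphi R Rphi :: "'a mat"
  assumes filt: "is_filtration n N Cf" and filt': "is_filtration n N C'f"
    and basis: "compatible_ordered_basis n N Cf" and basis': "compatible_ordered_basis n N C'f"
    and D: "D \<in> carrier_mat n n" "D * D = 0\<^sub>m n n" and D': "D' \<in> carrier_mat n n"
    and F: "F \<in> carrier_mat n n" "F * D = D' * F"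
    and G: "G \<in> carrier_mat n n" "F * G = 1\<^sub>m n" "G * F = 1\<^sub>m n"
    and Dphi: "Dphi = D * G"
    and V: "V \<in> carrier_mat n n" "upper_triangular V" "invertible_mat V"
    and Vphi: "Vphi \<in> carrier_mat n n" "upper_triangular Vphi" "invertible_mat Vphi"
    and R: "R = D * V" "reduced R"
    and Rphi: "Rphi = Dphi * Vphi" "reduced Rphi"
begin

lemma Dphi_carrier: "Dphi \<in> carrier_mat n n" and Rphi_carrier: "Rphi \<in> carrier_mat n n"
  using D G Dphi Vphi Rphi by auto

lemma F_Dphi: "F * Dphi = D'"
proof -
  have "F * Dphi = (D' * F) * G" unfolding Dphi using F D G by (simp flip: assoc_mult_mat)
  also have "\<dots> = D'" using F D' G by (simp add: assoc_mult_mat[of D' n n F n G n])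
  finally show ?thesis .
qed

lemma G_D': "G * D' = Dphi"
  unfolding F_Dphi[symmetric] using F G Dphi_carrier by (simp flip: assoc_mult_mat)

lemma col_Rphi: "j < n \<Longrightarrow> col Rphi j = Dphi *\<^sub>v col Vphi j"
  unfolding Rphi(1) by (rule col_mult2[OF Dphi_carrier Vphi(1)])

lemma col_R: "j < n \<Longrightarrow> col R j = D *\<^sub>v col V j"
  unfolding R(1) by (rule col_mult2[OF D(1) V(1)])

lemma D_Dphi_mult:
  assumes w: "w \<in> carrier_vec n"
  shows "D *\<^sub>v (Dphi *\<^sub>v w) = 0\<^sub>v n"
proof -
  have "D *\<^sub>v (Dphi *\<^sub>v w) = (D * D * G) *\<^sub>v w"
    unfolding Dphi using D(1) G(1) w by (simp add: assoc_mult_mat_vec[of _ n n _ n])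
  also have "\<dots> = 0\<^sub>v n" using D G(1) w by (intro eq_vecI) auto
  finally show ?thesis .
qed

lemma F_Dphi_mult: "w \<in> carrier_vec n \<Longrightarrow> F *\<^sub>v (Dphi *\<^sub>v w) = D' *\<^sub>v w"
  using F_Dphi F Dphi_carrier by (simp flip: assoc_mult_mat_vec)

definition bar :: "nat + nat \<Rightarrow> nat set" where
  "bar \<beta> = (case \<beta> of
     Inl j \<Rightarrow> supp N Cf (col Rphi j) - supp N C'f (col Vphi j)
   | Inr i \<Rightarrow> supp N Cf (col V i))"

definition gen :: "nat + nat \<Rightarrow> 'a vec" where
  "gen \<beta> = (case \<beta> of Inl j \<Rightarrow> col Rphi j | Inr i \<Rightarrow> col V i)"

definition gens :: "(nat + nat) list" where
  "gens = map Inl (filter (\<lambda>j. col Rphi j \<noteq> 0\<^sub>v n \<and> bar (Inl j) \<noteq> {}) [0..<n])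
        @ map Inr (filter (\<lambda>i. col R i = 0\<^sub>v n \<and> i \<notin> pivs Rphi) [0..<n])"

lemma mem_gens:
  "\<beta> \<in> set gens \<longleftrightarrow>
     (\<exists>j<n. \<beta> = Inl j \<and> col Rphi j \<noteq> 0\<^sub>v n \<and> bar (Inl j) \<noteq> {}) \<or>
     (\<exists>i<n. \<beta> = Inr i \<and> col R i = 0\<^sub>v n \<and> i \<notin> pivs Rphi)"
  unfolding gens_def by auto

lemma distinct_gens: "distinct gens"
  unfolding gens_def by (auto simp: distinct_map inj_on_def)

lemma mset_map_bar_gens:
  "mset (map bar gens) =
     image_mset (\<lambda>j. supp N Cf (col Rphi j) - supp N C'f (col Vphi j))
       (filter_mset (\<lambda>j. col Rphi j \<noteq> 0\<^sub>v n \<and>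
                           supp N Cf (col Rphi j) - supp N C'f (col Vphi j) \<noteq> {})
          (mset [0..<n]))
     + image_mset (\<lambda>i. supp N Cf (col V i))
       (filter_mset (\<lambda>i. col R i = 0\<^sub>v n \<and> i \<notin> pivs Rphi) (mset [0..<n]))"
  unfolding gens_def bar_def by (simp add: mset_filter comp_def)

lemma gen_carrier: "gen \<beta> \<in> carrier_vec n"
  using Rphi_carrier V(1) by (auto simp: gen_def split: sum.split)

lemma gen_nonzero: "\<beta> \<in> set gens \<Longrightarrow> gen \<beta> \<noteq> 0\<^sub>v n"
  unfolding mem_gens gen_def using upper_triangular_col(1)[OF V] by auto

lemma gen_cycle:
  assumes "\<beta> \<in> set gens" "t \<in> bar \<beta>"
  shows "gen \<beta> \<in> cycles D (Cf t)"
proof -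
  have "D *\<^sub>v gen \<beta> = 0\<^sub>v n"
    using assms(1) col_R D_Dphi_mult[OF carrier_vecI] col_Rphi Vphi(1)
    unfolding mem_gens gen_def by auto
  moreover have "gen \<beta> \<in> Cf t"
    using assms unfolding mem_gens gen_def bar_def supp_def by auto
  ultimately show ?thesis unfolding cycles_def using D(1) by simp
qed

lemma F_gen_boundary:
  assumes \<beta>: "\<beta> \<in> set gens" and st: "s \<le> t" "t \<le> N" and s: "s \<in> bar \<beta>" and t: "t \<notin> bar \<beta>"
  shows "F *\<^sub>v gen \<beta> \<in> boundaries D' (C'f t)"
proof -
  from \<beta> consider (fin) j where "\<beta> = Inl j" "j < n" | (ess) i where "\<beta> = Inr i"
    unfolding mem_gens by auto
  then show ?thesis
  proof cases
    case fin
    have "t \<in> supp N Cf (col Rphi j)"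
      using supp_up_closed[OF filt _ st] s fin(1) unfolding bar_def by auto
    then have "col Vphi j \<in> C'f t" using t fin(1) unfolding bar_def supp_def by auto
    moreover have "F *\<^sub>v gen \<beta> = D' *\<^sub>v col Vphi j"
      using fin col_Rphi F_Dphi_mult Vphi(1) unfolding gen_def by simp
    ultimately show ?thesis unfolding boundaries_def by auto
  next
    case ess
    then show ?thesis using supp_up_closed[OF filt _ st] s t unfolding bar_def by auto
  qed
qed

lemma is_interval_bar:
  assumes "\<beta> \<in> set gens"
  shows "is_interval N (bar \<beta>)"
  using assms unfolding mem_gens
proof (elim disjE exE conjE)
  fix j assume "\<beta> = Inl j" "bar (Inl j) \<noteq> {}"
  then show ?thesis using is_interval_supp_diff[OF filt filt'] unfolding bar_def by simp
next
  fix i assume "\<beta> = Inr i" "i < n"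
  then show ?thesis using is_interval_supp[OF filt] V(1) unfolding bar_def by simp
qed

lemma vec_piv_gen_Inr: "i < n \<Longrightarrow> vec_piv (gen (Inr i)) = i"
  unfolding gen_def using upper_triangular_col(2)[OF V] by simp

lemma inj_on_gen_piv: "inj_on (\<lambda>\<beta>. vec_piv (gen \<beta>)) (set gens)"
proof (rule inj_onI)
  fix \<beta> \<gamma> assume \<beta>: "\<beta> \<in> set gens" and \<gamma>: "\<gamma> \<in> set gens"
    and eq: "vec_piv (gen \<beta>) = vec_piv (gen \<gamma>)"
  have Inl_Inr: False if "j < n" "col Rphi j \<noteq> 0\<^sub>v n" "i \<notin> pivs Rphi" "vec_piv (col Rphi j) = i" for i j
    using that Rphi_carrier pivs_iff[of i Rphi] by auto
  from \<beta> \<gamma> show "\<beta> = \<gamma>"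
    unfolding mem_gens
  proof (elim disjE exE conjE)
    fix j j' assume "\<beta> = Inl j" "j < n" "col Rphi j \<noteq> 0\<^sub>v n" "\<gamma> = Inl j'" "j' < n" "col Rphi j' \<noteq> 0\<^sub>v n"
    then show "\<beta> = \<gamma>"
      using eq reduced_inj_on_vec_piv[OF Rphi(2)] Rphi_carrier unfolding gen_def inj_on_def by auto
  qed (use eq vec_piv_gen_Inr Inl_Inr in \<open>auto simp: gen_def\<close>)
qed

lemma gen_piv_ne_bounded_piv:
  assumes \<beta>: "\<beta> \<in> set gens" "t \<in> bar \<beta>" "t \<le> N"
    and j: "j < n" "col Rphi j \<noteq> 0\<^sub>v n" "col Vphi j \<in> C'f t"
  shows "vec_piv (gen \<beta>) \<noteq> vec_piv (col Rphi j)"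
proof -
  from \<beta>(1) consider (fin) j' where "\<beta> = Inl j'" "j' < n" "col Rphi j' \<noteq> 0\<^sub>v n"
    | (ess) i where "\<beta> = Inr i" "i < n" "i \<notin> pivs Rphi"
    unfolding mem_gens by auto
  then show ?thesis
  proof cases
    case fin
    have "j' \<noteq> j" using \<beta>(2,3) j(3) fin(1) unfolding bar_def supp_def by auto
    then show ?thesis
      using fin j reduced_inj_on_vec_piv[OF Rphi(2)] Rphi_carrier
      unfolding gen_def inj_on_def by auto
  next
    case ess
    then show ?thesis using j pivs_iff[of i Rphi] Rphi_carrier vec_piv_gen_Inr by auto
  qed
qed

definition gen_mat :: "'a mat" where
  "gen_mat = mat_of_cols n (map gen gens)"

abbreviation coefs :: "nat \<Rightarrow> 'a vec set" where
  "coefs t \<equiv> carrier (int_sum_mod TYPE('a) (map bar gens) t)"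

lemma gen_mat_carrier: "gen_mat \<in> carrier_mat n (length gens)"
  unfolding gen_mat_def using mat_of_cols_carrier(1)[of n "map gen gens"] by simp

lemma col_gen_mat: "\<alpha> < length gens \<Longrightarrow> col gen_mat \<alpha> = gen (gens ! \<alpha>)"
  unfolding gen_mat_def using gen_carrier by (subst col_mat_of_cols) auto

lemma coefs_iff:
  "a \<in> coefs t \<longleftrightarrow> a \<in> carrier_vec (length gens) \<and> (\<forall>\<alpha><length gens. a $ \<alpha> \<noteq> 0 \<longrightarrow> t \<in> bar (gens ! \<alpha>))"
  unfolding carrier_int_sum_mod by auto

lemma gen_mat_mult_cycle:
  assumes t: "t \<le> N" and a: "a \<in> coefs t"
  shows "gen_mat *\<^sub>v a \<in> cycles D (Cf t)"
  using a
  by (intro mult_mat_vec_in_vec_subspace[OF vec_subspace_cycles[OF D(1)] gen_mat_carrier])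
    (auto simp: coefs_iff col_gen_mat intro: gen_cycle is_filtration_vec_subspace[OF filt t])

text \<open>F maps gen_mat a + Dphi w to F (gen_mat a) + D' w, so every cycle in gen_span t
  represents the class of some F (gen_mat a) with a \<in> coefs t.\<close>

definition gen_span :: "nat \<Rightarrow> 'a vec set" where
  "gen_span t =
     {x + y | x y. x \<in> (*\<^sub>v) gen_mat ` coefs t \<and> y \<in> (*\<^sub>v) Dphi ` C'f t}"

lemma vec_subspace_gen_span:
  assumes t: "t \<le> N"
  shows "vec_subspace n (gen_span t)"
proof -
  have "vec_subspace (length gens) (coefs t)"
    using vec_subspace_int_sum_mod[of "map bar gens" t] by simp
  then show ?thesis
    unfolding gen_span_def
    by (intro vec_subspace_set_plus vec_subspace_image[OF gen_mat_carrier]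
        vec_subspace_image[OF Dphi_carrier] is_filtration_vec_subspace[OF filt' t])
qed

lemma gen_in_gen_span:
  assumes \<beta>: "\<beta> \<in> set gens" and t: "t \<in> bar \<beta>" "t \<le> N"
  shows "gen \<beta> \<in> gen_span t"
proof -
  obtain \<alpha> where \<alpha>: "\<alpha> < length gens" "gens ! \<alpha> = \<beta>" using \<beta> by (metis in_set_conv_nth)
  show ?thesis
    unfolding gen_span_def
  proof (intro CollectI exI conjI)
    show "gen \<beta> = gen_mat *\<^sub>v unit_vec (length gens) \<alpha> + Dphi *\<^sub>v 0\<^sub>v n"
      using \<alpha> Dphi_carrier col_gen_mat[OF \<alpha>(1)] gen_carrier[of \<beta>]
        mult_mat_vec_unit_vec[OF gen_mat_carrier \<alpha>(1)]
      by (intro eq_vecI) auto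
    show "gen_mat *\<^sub>v unit_vec (length gens) \<alpha> \<in> (*\<^sub>v) gen_mat ` coefs t"
      using \<alpha> t(1) by (auto simp: coefs_iff)
    show "Dphi *\<^sub>v 0\<^sub>v n \<in> (*\<^sub>v) Dphi ` C'f t"
      using vec_subspace_zero[OF is_filtration_vec_subspace[OF filt' t(2)]] by simp
  qed
qed

lemma Dphi_in_gen_span:
  assumes w: "w \<in> C'f t"
  shows "Dphi *\<^sub>v w \<in> gen_span t"
  unfolding gen_span_def
proof (intro CollectI exI conjI)
  show "Dphi *\<^sub>v w = gen_mat *\<^sub>v 0\<^sub>v (length gens) + Dphi *\<^sub>v w"
    using gen_mat_carrier Dphi_carrier by (intro eq_vecI) auto
  show "gen_mat *\<^sub>v 0\<^sub>v (length gens) \<in> (*\<^sub>v) gen_mat ` coefs t"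
    by (auto simp: coefs_iff)
qed (use w in simp)

lemma col_Rphi_in_gen_span:
  assumes t: "t \<le> N" and j: "j < n" "col Rphi j \<noteq> 0\<^sub>v n" "col Rphi j \<in> Cf t"
  shows "col Rphi j \<in> gen_span t"
proof (cases "col Vphi j \<in> C'f t")
  case True
  then show ?thesis using Dphi_in_gen_span col_Rphi[OF j(1)] by simp
next
  case False
  then have "t \<in> bar (Inl j)" using j(3) t unfolding bar_def supp_def by auto
  moreover from this have "Inl j \<in> set gens" using j unfolding mem_gens by auto
  ultimately show ?thesis using gen_in_gen_span[OF _ _ t] unfolding gen_def by fastforce
qed

lemma col_V_in_gen_span:
  assumes t: "t \<le> N" and i: "i < n" "col R i = 0\<^sub>v n" "i \<notin> pivs Rphi" "col V i \<in> Cf t"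
  shows "col V i \<in> gen_span t"
proof -
  have "t \<in> bar (Inr i)" using i(4) t unfolding bar_def supp_def by auto
  moreover have "Inr i \<in> set gens" using i unfolding mem_gens by auto
  ultimately show ?thesis using gen_in_gen_span[OF _ _ t] unfolding gen_def by fastforce
qed

lemma cycle_reducer:
  assumes t: "t \<le> N" and z: "z \<in> cycles D (Cf t)" "z \<noteq> 0\<^sub>v n"
  shows "\<exists>r \<in> cycles D (Cf t) \<inter> gen_span t. r \<noteq> 0\<^sub>v n \<and> vec_piv r = vec_piv z"
proof -
  let ?b = "vec_piv z"
  have zC: "z \<in> Cf t" and Dz: "D *\<^sub>v z = 0\<^sub>v n" using z(1) D(1) unfolding cycles_def by auto
  have zc: "z \<in> carrier_vec n" using vec_subspace_carrier[OF is_filtration_vec_subspace[OF filt t] zC] .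
  have b: "?b < n" "z $ ?b \<noteq> 0" using vec_piv_less[of z] vec_piv_nonzero[of z] zc z(2) by auto
  have in_Cf: "r \<in> Cf t" if "r \<in> carrier_vec n" "vec_piv r = ?b" for r
    using that vec_piv_above_zero[of r]
    by (intro compatible_basis_mem_if_vanishes_above[OF filt basis t zC b]) auto
  show ?thesis
  proof (cases "?b \<in> pivs Rphi")
    case True
    then obtain j where j: "j < n" "col Rphi j \<noteq> 0\<^sub>v n" "vec_piv (col Rphi j) = ?b"
      using pivs_iff[of ?b Rphi] Rphi_carrier by auto
    have "col Rphi j \<in> Cf t" using in_Cf[OF _ j(3)] Rphi_carrier j(1) by simp
    moreover have "D *\<^sub>v col Rphi j = 0\<^sub>v n"
      using col_Rphi[OF j(1)] D_Dphi_mult[of "col Vphi j"] Vphi(1) j(1) by simp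
    ultimately show ?thesis
      using col_Rphi_in_gen_span[OF t j(1,2)] j D(1) unfolding cycles_def by auto
  next
    case False
    have R0: "col R ?b = 0\<^sub>v n" using reduced_col_zero_at_cycle_piv[OF D(1) V R zc z(2) Dz] .
    have "col V ?b \<in> Cf t" using in_Cf[OF _ upper_triangular_col(2)[OF V b(1)]] V(1) b(1) by simp
    moreover have "D *\<^sub>v col V ?b = 0\<^sub>v n" using col_R[OF b(1)] R0 by simp
    ultimately show ?thesis
      using col_V_in_gen_span[OF t b(1) R0 False] upper_triangular_col[OF V b(1)] D(1)
      unfolding cycles_def by auto
  qed
qed

lemma cycles_subset_gen_span: "t \<le> N \<Longrightarrow> cycles D (Cf t) \<subseteq> gen_span t"
  by (rule vec_subspace_subset_if_pivots[OF vec_subspace_cycles[OF D(1)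
        is_filtration_vec_subspace[OF filt]] vec_subspace_gen_span cycle_reducer])

lemma gen_mat_mult_vec_piv:
  assumes a: "a \<in> carrier_vec (length gens)" "a \<noteq> 0\<^sub>v (length gens)"
  obtains \<alpha> where "\<alpha> < length gens" "a $ \<alpha> \<noteq> 0" "gen_mat *\<^sub>v a \<noteq> 0\<^sub>v n"
    "vec_piv (gen_mat *\<^sub>v a) = vec_piv (gen (gens ! \<alpha>))"
proof -
  let ?A = "{\<alpha>. \<alpha> < length gens \<and> col gen_mat \<alpha> \<noteq> 0\<^sub>v n \<and> a $ \<alpha> \<noteq> 0}"
  obtain \<alpha>0 where "\<alpha>0 < length gens" "a $ \<alpha>0 \<noteq> 0"
    using a by (metis eq_vecI carrier_vecD index_zero_vec)
  then have "?A \<noteq> {}" using col_gen_mat gen_nonzero nth_mem by auto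
  moreover have "inj_on (\<lambda>\<alpha>. vec_piv (col gen_mat \<alpha>)) ?A"
  proof (rule inj_onI)
    fix \<alpha> \<alpha>' assume \<alpha>: "\<alpha> \<in> ?A" "\<alpha>' \<in> ?A" "vec_piv (col gen_mat \<alpha>) = vec_piv (col gen_mat \<alpha>')"
    then have "gens ! \<alpha> = gens ! \<alpha>'"
      using inj_on_gen_piv col_gen_mat unfolding inj_on_def by auto
    then show "\<alpha> = \<alpha>'" using distinct_gens \<alpha> by (simp add: nth_eq_iff_index_eq)
  qed
  ultimately show thesis
    using mult_mat_vec_distinct_col_pivs[OF gen_mat_carrier a(1)] that col_gen_mat by auto
qed

lemma coefs_zero_if_boundary:
  assumes t: "t \<le> N" and a: "a \<in> coefs t" and w: "w \<in> C'f t"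
    and eq: "F *\<^sub>v (gen_mat *\<^sub>v a) = D' *\<^sub>v w"
  shows "a = 0\<^sub>v (length gens)"
proof (rule ccontr)
  assume "a \<noteq> 0\<^sub>v (length gens)"
  moreover have ac: "a \<in> carrier_vec (length gens)" using a by (simp add: coefs_iff)
  ultimately obtain \<alpha> where \<alpha>: "\<alpha> < length gens" "a $ \<alpha> \<noteq> 0" "gen_mat *\<^sub>v a \<noteq> 0\<^sub>v n"
    "vec_piv (gen_mat *\<^sub>v a) = vec_piv (gen (gens ! \<alpha>))"
    using gen_mat_mult_vec_piv by blast
  have wc: "w \<in> carrier_vec n" using vec_subspace_carrier[OF is_filtration_vec_subspace[OF filt' t] w] .
  obtain u where u: "u \<in> carrier_vec n" "Vphi *\<^sub>v u = w"
    and u_supp: "\<And>j. j < n \<Longrightarrow> u $ j \<noteq> 0 \<Longrightarrow> col Vphi j \<in> C'f t"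
    using upper_triangular_solve_in_filtration[OF filt' basis' t Vphi w] by blast
  have "gen_mat *\<^sub>v a = (G * F) *\<^sub>v (gen_mat *\<^sub>v a)" using G(3) gen_mat_carrier ac by simp
  also have "\<dots> = (G * D') *\<^sub>v w"
    using eq G(1) F(1) D' gen_mat_carrier ac wc by (simp add: assoc_mult_mat_vec)
  also have "\<dots> = Rphi *\<^sub>v u"
    unfolding G_D' Rphi(1) u(2)[symmetric] using Dphi_carrier Vphi(1) u(1) by simp
  finally have y: "gen_mat *\<^sub>v a = Rphi *\<^sub>v u" .
  then obtain j where j: "j < n" "col Rphi j \<noteq> 0\<^sub>v n" "u $ j \<noteq> 0"
    "vec_piv (Rphi *\<^sub>v u) = vec_piv (col Rphi j)"
    using reduced_mult_vec_piv[OF Rphi_carrier Rphi(2) u(1)] \<alpha>(3) by metis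
  have "t \<in> bar (gens ! \<alpha>)" using a \<alpha>(1,2) by (simp add: coefs_iff)
  then have "vec_piv (gen (gens ! \<alpha>)) \<noteq> vec_piv (col Rphi j)"
    using gen_piv_ne_bounded_piv[OF nth_mem[OF \<alpha>(1)] _ t j(1,2) u_supp[OF j(1,3)]] by blast
  then show False using \<alpha>(4) j(4) y by simp
qed

lemma boundaries_vec_subspace: "t \<le> N \<Longrightarrow> vec_subspace n (boundaries D' (C'f t))"
  unfolding boundaries_eq_image by (intro vec_subspace_image[OF D'] is_filtration_vec_subspace[OF filt'])

lemma F_gen_mat_mult: "a \<in> carrier_vec (length gens) \<Longrightarrow> (F * gen_mat) *\<^sub>v a = F *\<^sub>v (gen_mat *\<^sub>v a)"
  using F(1) gen_mat_carrier by (simp add: assoc_mult_mat_vec)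

lemma F_gen_mat_mult_carrier: "(F * gen_mat) *\<^sub>v a \<in> carrier_vec n"
  using F(1) by (intro carrier_vecI) simp

lemma inj_on_hclass_gen_mat:
  assumes t: "t \<le> N"
  shows "inj_on (\<lambda>a. hclass (boundaries D' (C'f t)) ((F * gen_mat) *\<^sub>v a)) (coefs t)"
proof (rule inj_onI)
  fix a b assume a: "a \<in> coefs t" and b: "b \<in> coefs t"
    and eq: "hclass (boundaries D' (C'f t)) ((F * gen_mat) *\<^sub>v a) =
      hclass (boundaries D' (C'f t)) ((F * gen_mat) *\<^sub>v b)"
  have ac: "a \<in> carrier_vec (length gens)" and bc: "b \<in> carrier_vec (length gens)"
    using a b by (simp_all add: coefs_iff)
  have ab: "a - b \<in> coefs t" using vec_subspace_diff[OF vec_subspace_int_sum_mod a b] .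
  have "(F * gen_mat) *\<^sub>v a - (F * gen_mat) *\<^sub>v b \<in> boundaries D' (C'f t)"
    using eq hclass_eq_iff[OF boundaries_vec_subspace[OF t] F_gen_mat_mult_carrier F_gen_mat_mult_carrier]
    by blast
  moreover have "(F * gen_mat) *\<^sub>v a - (F * gen_mat) *\<^sub>v b = F *\<^sub>v (gen_mat *\<^sub>v (a - b))"
    using F_gen_mat_mult[of "a - b"] ac bc F(1) gen_mat_carrier by (simp add: mult_minus_distrib_mat_vec)
  ultimately obtain w where "w \<in> C'f t" "F *\<^sub>v (gen_mat *\<^sub>v (a - b)) = D' *\<^sub>v w"
    unfolding boundaries_def by auto
  then have "a - b = 0\<^sub>v (length gens)" using coefs_zero_if_boundary[OF t ab] by blast
  moreover have "a = (a - b) + b" using ac bc by (intro eq_vecI) auto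
  ultimately show "a = b" using bc by simp
qed

lemma hclass_gen_mat_image:
  assumes t: "t \<le> N"
  shows "(\<lambda>a. hclass (boundaries D' (C'f t)) ((F * gen_mat) *\<^sub>v a)) ` coefs t =
    carrier (imH_mod n Cf D C'f D' F t)"
proof -
  let ?B = "boundaries D' (C'f t)"
  have img: "carrier (imH_mod n Cf D C'f D' F t) = hclass ?B ` (*\<^sub>v) F ` cycles D (Cf t)"
    unfolding imH_mod_def carrier_quot_mod ..
  have "hclass ?B (F *\<^sub>v z) \<in> (\<lambda>a. hclass ?B ((F * gen_mat) *\<^sub>v a)) ` coefs t"
    if z: "z \<in> cycles D (Cf t)" for z
  proof -
    have "z \<in> gen_span t" using cycles_subset_gen_span[OF t] z by auto
    then obtain a w where a: "a \<in> coefs t" and w: "w \<in> C'f t"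
      and zaw: "z = gen_mat *\<^sub>v a + Dphi *\<^sub>v w"
      unfolding gen_span_def by auto
    have wc: "w \<in> carrier_vec n" using vec_subspace_carrier[OF is_filtration_vec_subspace[OF filt' t] w] .
    have ac: "a \<in> carrier_vec (length gens)" using a by (simp add: coefs_iff)
    have "F *\<^sub>v z = (F * gen_mat) *\<^sub>v a + D' *\<^sub>v w"
      unfolding zaw F_gen_mat_mult[OF ac] F_Dphi_mult[OF wc, symmetric]
      using F(1) gen_mat_carrier Dphi_carrier ac wc by (simp add: mult_add_distrib_mat_vec)
    then have "F *\<^sub>v z - (F * gen_mat) *\<^sub>v a = D' *\<^sub>v w"
      using F_gen_mat_mult_carrier[of a] D' wc F(1) by (intro eq_vecI) auto
    then have "F *\<^sub>v z - (F * gen_mat) *\<^sub>v a \<in> ?B" using w unfolding boundaries_def by auto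
    moreover have "F *\<^sub>v z \<in> carrier_vec n" using F(1) by (intro carrier_vecI) simp
    ultimately have "hclass ?B (F *\<^sub>v z) = hclass ?B ((F * gen_mat) *\<^sub>v a)"
      using hclass_eq_iff[OF boundaries_vec_subspace[OF t] _ F_gen_mat_mult_carrier] by simp
    then show ?thesis using a by blast
  qed
  moreover have "(F * gen_mat) *\<^sub>v a \<in> (*\<^sub>v) F ` cycles D (Cf t)" if "a \<in> coefs t" for a
    using F_gen_mat_mult gen_mat_mult_cycle[OF t that] that by (simp add: coefs_iff)
  ultimately show ?thesis unfolding img by blast
qed

lemma F_gen_mat_natural:
  assumes st: "s \<le> t" "t \<le> N" and a: "a \<in> coefs s"
  shows "(F * gen_mat) *\<^sub>v a - (F * gen_mat) *\<^sub>v int_sum_map (map bar gens) s t a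
    \<in> boundaries D' (C'f t)"
proof -
  let ?a' = "int_sum_map (map bar gens) s t a"
  have ac: "a \<in> carrier_vec (length gens)" using a by (simp add: coefs_iff)
  have a'c: "?a' \<in> carrier_vec (length gens)" by (simp add: int_sum_map_def)
  have FZ: "F * gen_mat \<in> carrier_mat n (length gens)" using F(1) gen_mat_carrier by simp
  have "(F * gen_mat) *\<^sub>v a - (F * gen_mat) *\<^sub>v ?a' = (F * gen_mat) *\<^sub>v (a - ?a')"
    using FZ ac a'c by (simp add: mult_minus_distrib_mat_vec)
  also have "\<dots> \<in> boundaries D' (C'f t)"
  proof (rule mult_mat_vec_in_vec_subspace[OF boundaries_vec_subspace[OF st(2)] FZ])
    show "a - ?a' \<in> carrier_vec (length gens)" using ac a'c by simp
    fix \<alpha> assume \<alpha>: "\<alpha> < length gens" "(a - ?a') $ \<alpha> \<noteq> 0"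
    then have "a $ \<alpha> \<noteq> 0" "\<not> (s \<in> bar (gens ! \<alpha>) \<and> t \<in> bar (gens ! \<alpha>))"
      using ac by (auto simp: int_sum_map_def split: if_splits)
    moreover have "s \<in> bar (gens ! \<alpha>)" if "a $ \<alpha> \<noteq> 0" using a \<alpha>(1) that by (simp add: coefs_iff)
    ultimately have "F *\<^sub>v gen (gens ! \<alpha>) \<in> boundaries D' (C'f t)"
      using F_gen_boundary[OF nth_mem[OF \<alpha>(1)] st] by blast
    then show "col (F * gen_mat) \<alpha> \<in> boundaries D' (C'f t)"
      using col_mult2[OF F(1) gen_mat_carrier \<alpha>(1)] col_gen_mat[OF \<alpha>(1)] by simp
  qed
  finally show ?thesis .
qed

theorem has_barcode_imH:
  "has_barcode N (imH_mod n Cf D C'f D' F) (imH_map C'f D') (mset (map bar gens))"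
proof -
  let ?B = "\<lambda>t. boundaries D' (C'f t)" and ?S = "\<lambda>t. (*\<^sub>v) F ` cycles D (Cf t)"
  have imH: "imH_mod n Cf D C'f D' F = (\<lambda>t. quot_mod n (?B t) (?S t))"
    by (simp add: imH_mod_def fun_eq_iff)
  have map: "imH_map C'f D' = (\<lambda>s t. quot_map (?B t))"
    by (simp add: imH_map_eq_quot_map fun_eq_iff)
  have B_mono: "?B s \<subseteq> ?B t" if "s \<le> t" "t \<le> N" for s t
    using is_filtration_mono[OF filt' that] unfolding boundaries_def by blast
  have S: "vec_subspace n (?S t)" if "t \<le> N" for t
    using vec_subspace_image[OF F(1) vec_subspace_cycles[OF D(1) is_filtration_vec_subspace[OF filt that]]] .
  have S_mono: "?S s \<subseteq> ?S t" if "s \<le> t" "t \<le> N" for s t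
    using is_filtration_mono[OF filt that] unfolding cycles_def by blast
  show ?thesis
    unfolding has_barcode_def imH map
  proof (intro conjI exI[of _ "map bar gens"])
    show "pers_mod N (\<lambda>t. quot_mod n (?B t) (?S t)) (\<lambda>s t. quot_map (?B t))"
      by (rule pers_mod_quot_mod[OF boundaries_vec_subspace S B_mono S_mono])
    show "\<forall>I\<in>#mset (map bar gens). is_interval N I" using is_interval_bar by auto
    show "pers_iso N (\<lambda>t. quot_mod n (?B t) (?S t)) (\<lambda>s t. quot_map (?B t))
        (int_sum_mod TYPE('a) (map bar gens)) (int_sum_map (map bar gens))"
      using inj_on_hclass_gen_mat hclass_gen_mat_image[unfolded imH] F_gen_mat_natural F(1) gen_mat_carrier
      by (intro pers_iso_int_sum_mod[where M = "F * gen_mat"] boundaries_vec_subspace B_mono)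
        (auto simp: bij_betw_def)
  qed simp
qed

end

theorem theorem3p6:
  fixes n N :: nat
    and Cf C'f :: "nat \<Rightarrow> 'a::field vec set"
    and deg deg' :: "nat \<Rightarrow> int"
    and D D' F G Dphi V Vphi R Rphi :: "'a mat"
  assumes C: "filtered_chain_complex n N deg Cf D"
    and C': "filtered_chain_complex n N deg' C'f D'"
    and basisC: "compatible_ordered_basis n N Cf"
    and basisC': "compatible_ordered_basis n N C'f"
    and F_carrier: "F \<in> carrier_mat n n"
    and F_deg: "\<And>i j. i < n \<Longrightarrow> j < n \<Longrightarrow> F $$ (i, j) \<noteq> 0 \<Longrightarrow> deg' i = deg j"
    and F_chain: "F * D = D' * F"
    and F_filt: "\<And>t v. t \<le> N \<Longrightarrow> v \<in> Cf t \<Longrightarrow> F *\<^sub>v v \<in> C'f t"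
    and F_inj: "\<And>t. t \<le> N \<Longrightarrow> inj_on (\<lambda>v. F *\<^sub>v v) (Cf t)"
    and F_iso: "invertible_mat F"
    and G_inv: "G \<in> carrier_mat n n" "F * G = 1\<^sub>m n" "G * F = 1\<^sub>m n"
    and Dphi: "Dphi = D * G"
    and V: "V \<in> carrier_mat n n" "upper_triangular V" "invertible_mat V"
    and Vphi: "Vphi \<in> carrier_mat n n" "upper_triangular Vphi" "invertible_mat Vphi"
    and R: "R = D * V" "reduced R"
    and Rphi: "Rphi = Dphi * Vphi" "reduced Rphi"
  shows "has_barcode N (imH_mod n Cf D C'f D' F) (imH_map C'f D')
     (image_mset (\<lambda>j. supp N Cf (col Rphi j) - supp N C'f (col Vphi j))
        (filter_mset (\<lambda>j. col Rphi j \<noteq> 0\<^sub>v n \<and>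
                            supp N Cf (col Rphi j) - supp N C'f (col Vphi j) \<noteq> {})
           (mset [0..<n]))
      + image_mset (\<lambda>i. supp N Cf (col V i))
        (filter_mset (\<lambda>i. col R i = 0\<^sub>v n \<and> i \<notin> pivs Rphi) (mset [0..<n])))"
proof -
  interpret image_barcode n N Cf C'f D D' F G Dphi V Vphi R Rphi
    using C C' basisC basisC' F_carrier F_chain G_inv Dphi V Vphi R Rphi
    by unfold_locales (auto simp: filtered_chain_complex_def)
  show ?thesis using has_barcode_imH unfolding mset_map_bar_gens .
qed

end
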